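(* Let $\overline{D}\subset\mathbb{C}$ be a closed disc with centre at $0$, let $0<\alpha<1$, and let $F:\overline{D}\to\mathbb{C}$ be a function of Hölder class $\mathcal{C}^\alpha(\overline{D})$. Assume that there exist a nowhere-dense subset $E\subset\overline{D}$ and constants $K>0$, $\nu\geq 1$ such that for each $\zeta\in\overline{D}\setminus E$ there exists a constant $C_\zeta\in\mathbb{C}$ with $|C_\zeta|=1$ so that $$C_\zeta\,(z-\zeta)\bigl(F(z)-F(\zeta)\bigr)\in\left\{u+iv\in\mathbb{C}: u\geq 0,\ |v|\leq K u^{1/\nu}\right\}\quad\text{for all } z\in\overline{D}.$$ Then the graph $\Gamma_{\overline{D}}(F)$ is polynomially convex. If, additionally, $F\in\mathcal{C}^1(\overline{D})$ and the set $\{z\in\overline{D}:\partial F/\partial\overline{z}\,(z)=0\}$ is nowhere dense and finitely connected, then $[z,F]_{\overline{D}}=\mathcal{C}(\overline{D})$.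
   Context: $\Gamma_{\overline{D}}(F):=\{(z,F(z)):z\in\overline{D}\}\subset\mathbb{C}^2$. A compact set $X\subset\mathbb{C}^n$ is polynomially convex if it equals its polynomially convex hull $\widehat{X}=\{x\in\mathbb{C}^n: |p(x)|\leq\sup_X|p| \text{ for every holomorphic polynomial } p\}$. $[z,F]_{\overline{D}}$ denotes the uniform algebra on $\overline{D}$ generated by $z$ and $F$, i.e. the closure in $\mathcal{C}(\overline{D})$ (complex-valued continuous functions, sup norm) of the polynomials in $z$ and $F$. $\mathcal{C}^1(\overline{D})$ denotes the complex-valued functions that are continuously differentiable (in the real sense) up to the boundary. A subset $S\subset\mathbb{C}$ is finitely connected if $\widehat{\mathbb{C}}\setminus S$ has finitely many connected components, where $\widehat{\mathbb{C}}$ is the one-point compactification of $\mathbb{C}$. *)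

theory Defs
  imports "HOL-Analysis.Analysis"
begin

definition holomorphic_polynomials :: "(complex ^ 'n \<Rightarrow> complex) set" where
  "holomorphic_polynomials =
     {(\<lambda>x. \<Sum>m\<in>A. c m * (\<Prod>i\<in>UNIV. (x $ i) ^ m i)) | (A :: ('n \<Rightarrow> nat) set) c. finite A}"

text \<open>For nonempty compact \<open>X\<close> the supremum below is over a nonempty bounded set of reals;
  otherwise the value of \<open>Sup\<close> is unspecified and the hull is not meaningful.\<close>

definition polynomial_hull :: "(complex ^ 'n) set \<Rightarrow> (complex ^ 'n) set" where
  "polynomial_hull X =
     {x. \<forall>p\<in>holomorphic_polynomials. cmod (p x) \<le> (SUP y\<in>X. cmod (p y))}"

definition polynomially_convex :: "(complex ^ 'n) set \<Rightarrow> bool" where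
  "polynomially_convex X \<longleftrightarrow> compact X \<and> polynomial_hull X = X"

definition graph_over :: "complex set \<Rightarrow> (complex \<Rightarrow> complex) \<Rightarrow> (complex ^ 2) set" where
  "graph_over S F = {vector [z, F z] | z. z \<in> S}"

definition holder_on :: "real \<Rightarrow> complex set \<Rightarrow> (complex \<Rightarrow> complex) \<Rightarrow> bool" where
  "holder_on \<alpha> S F \<longleftrightarrow>
     (\<exists>M. \<forall>z\<in>S. \<forall>w\<in>S. dist (F z) (F w) \<le> M * dist z w powr \<alpha>)"

text \<open>Real differentiability up to the boundary is expressed by one-sided (\<open>at z within S\<close>)
  derivatives. On a closed disc this agrees with being continuously differentiable in the interior
  with partial derivatives extending continuously to the boundary.\<close>

definition C1_on :: "complex set \<Rightarrow> (complex \<Rightarrow> complex) \<Rightarrow> bool" where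
  "C1_on S F \<longleftrightarrow>
     (\<exists>F' :: complex \<Rightarrow> complex \<Rightarrow>\<^sub>L complex.
        continuous_on S F' \<and>
        (\<forall>z\<in>S. (F has_derivative blinfun_apply (F' z)) (at z within S)))"

text \<open>The Wirtinger derivative \<open>(F\<^sub>x + \<i> F\<^sub>y) / 2\<close>. It is meant for sets such as closed discs,
  on which the derivative within the set is unique, also at boundary points.\<close>

definition dbar :: "complex set \<Rightarrow> (complex \<Rightarrow> complex) \<Rightarrow> complex \<Rightarrow> complex" where
  "dbar S F z =
     (let F' = frechet_derivative F (at z within S) in (F' 1 + \<i> * F' \<i>) / 2)"

definition nowhere_dense_in :: "'a topology \<Rightarrow> 'a set \<Rightarrow> bool" where
  "nowhere_dense_in X S \<longleftrightarrow> S \<subseteq> topspace X \<and> X interior_of (X closure_of S) = {}"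

text \<open>The Alexandroff compactification of the plane has points \<open>Some z\<close> and \<open>None\<close> (infinity).\<close>

definition finitely_connected :: "complex set \<Rightarrow> bool" where
  "finitely_connected S \<longleftrightarrow>
     finite (connected_components_of
       (subtopology (Alexandroff_compactification euclidean) (- Some ` S)))"

text \<open>The metric space of continuous functions on \<open>S\<close> with the supremum distance; its points are
  functions that are \<open>undefined\<close> outside \<open>S\<close>. For compact \<open>S\<close> the boundedness built into
  \<open>cfunspace\<close> is automatic.\<close>

definition C_space :: "complex set \<Rightarrow> (complex \<Rightarrow> complex) metric" where
  "C_space S = cfunspace (top_of_set S) euclidean_metric"

definition uniform_algebra_z :: "complex set \<Rightarrow> (complex \<Rightarrow> complex) \<Rightarrow> (complex \<Rightarrow> complex) set" where
  "uniform_algebra_z S F =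
     mtopology_of (C_space S) closure_of
       {restrict (\<lambda>z. p (vector [z, F z])) S | p :: complex ^ 2 \<Rightarrow> complex.
          p \<in> holomorphic_polynomials}"

end

theory Submission
  imports Defs "HOL-Complex_Analysis.Cauchy_Integral_Formula"
begin

text \<open>
  The hypothesis is closed under limits in \<open>\<zeta>\<close> and \<open>C\<close>, so it holds for every
  \<open>\<zeta>\<close> in the disc \<open>D\<close>, and \<open>P = C (z - \<zeta>) (w - F \<zeta>)\<close> maps the graph into the
  right half plane. Hence \<open>1 / (P + \<epsilon>)\<close> is a uniform limit of polynomials on the graph.

  If \<open>(z\<^sub>0, w\<^sub>0)\<close> is in the hull, take \<open>\<zeta> = z\<^sub>0\<close>: the functions
  \<open>(w - F z\<^sub>0) / (1 + n P)\<close> tend to zero uniformly on the graph and equal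
  \<open>w\<^sub>0 - F z\<^sub>0\<close> at \<open>(z\<^sub>0, w\<^sub>0)\<close>, which gives \<open>w\<^sub>0 = F z\<^sub>0\<close>.

  For the second part, \<open>C (F z - F \<zeta>) / (P + \<epsilon>)\<close> is in the algebra, is dominated by
  \<open>1 / \<bar>z - \<zeta>\<bar>\<close>, and tends to \<open>1 / (z - \<zeta>)\<close> off the level set of \<open>F\<close> through
  \<open>\<zeta>\<close>. Since the cusp meets the imaginary axis only at \<open>0\<close>, level sets are convex; they
  have no interior because the zero set of \<open>dbar D F\<close> has none, so they are null sets.
  Therefore \<open>cnj z\<close>, which is \<open>1 / \<pi>\<close> times the integral of \<open>1 / (z - \<zeta>)\<close> over
  \<open>\<zeta>\<close> in \<open>D\<close>, is in the algebra, and the Stone-Weierstrass theorem applies.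
\<close>

section \<open>Uniform limits of polynomials\<close>

lemma holomorphic_polynomials_monomial:
  "(\<lambda>x. a * (\<Prod>i\<in>UNIV. (x $ i) ^ m i)) \<in> holomorphic_polynomials"
  unfolding holomorphic_polynomials_def
  by (rule CollectI, rule exI[of _ "{m}"], rule exI[of _ "\<lambda>_. a"]) simp

lemma holomorphic_polynomials_const: "(\<lambda>x. a) \<in> holomorphic_polynomials"
  using holomorphic_polynomials_monomial[of a "\<lambda>_. 0"] by simp

lemma holomorphic_polynomials_nth:
  fixes i :: "'n::finite"
  shows "(\<lambda>x. x $ i) \<in> holomorphic_polynomials"
proof -
  have "(\<Prod>j\<in>UNIV. (x $ j) ^ (if j = i then 1 else 0)) = x $ i" for x :: "complex ^ 'n"
  proof -
    have "(\<Prod>j\<in>UNIV. (x $ j) ^ (if j = i then 1 else 0)) = (\<Prod>j\<in>UNIV. if j = i then x $ j else 1)"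
      by (rule prod.cong) auto
    then show ?thesis by simp
  qed
  then show ?thesis
    using holomorphic_polynomials_monomial[of 1 "\<lambda>j. if j = i then 1 else 0"] by simp
qed

lemma holomorphic_polynomials_add:
  assumes "p \<in> holomorphic_polynomials" "q \<in> holomorphic_polynomials"
  shows "(\<lambda>x. p x + q x) \<in> holomorphic_polynomials"
proof -
  obtain A c where A: "finite A" and p: "p = (\<lambda>x. \<Sum>m\<in>A. c m * (\<Prod>i\<in>UNIV. (x $ i) ^ m i))"
    using assms(1) by (auto simp: holomorphic_polynomials_def)
  obtain B d where B: "finite B" and q: "q = (\<lambda>x. \<Sum>m\<in>B. d m * (\<Prod>i\<in>UNIV. (x $ i) ^ m i))"
    using assms(2) by (auto simp: holomorphic_polynomials_def)
  define e where "e m = (if m \<in> A then c m else 0) + (if m \<in> B then d m else 0)" for m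
  have "p x + q x = (\<Sum>m\<in>A \<union> B. e m * (\<Prod>i\<in>UNIV. (x $ i) ^ m i))" for x
  proof -
    have "p x = (\<Sum>m\<in>A \<union> B. (if m \<in> A then c m else 0) * (\<Prod>i\<in>UNIV. (x $ i) ^ m i))"
      unfolding p using A B by (intro sum.mono_neutral_cong_left) auto
    moreover have "q x = (\<Sum>m\<in>A \<union> B. (if m \<in> B then d m else 0) * (\<Prod>i\<in>UNIV. (x $ i) ^ m i))"
      unfolding q using A B by (intro sum.mono_neutral_cong_left) auto
    ultimately show ?thesis
      by (simp add: e_def distrib_right sum.distrib)
  qed
  then show ?thesis
    unfolding holomorphic_polynomials_def using A B by blast
qed

lemma holomorphic_polynomials_sum:
  assumes "\<And>j. j \<in> J \<Longrightarrow> p j \<in> holomorphic_polynomials"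
  shows "(\<lambda>x. \<Sum>j\<in>J. p j x) \<in> holomorphic_polynomials"
  using assms
  by (induction J rule: infinite_finite_induct)
    (simp_all add: holomorphic_polynomials_const holomorphic_polynomials_add)

lemma holomorphic_polynomials_mult:
  assumes "p \<in> holomorphic_polynomials" "q \<in> holomorphic_polynomials"
  shows "(\<lambda>x. p x * q x) \<in> holomorphic_polynomials"
proof -
  obtain A c where p: "p = (\<lambda>x. \<Sum>m\<in>A. c m * (\<Prod>i\<in>UNIV. (x $ i) ^ m i))"
    using assms(1) by (auto simp: holomorphic_polynomials_def)
  obtain B d where q: "q = (\<lambda>x. \<Sum>m\<in>B. d m * (\<Prod>i\<in>UNIV. (x $ i) ^ m i))"
    using assms(2) by (auto simp: holomorphic_polynomials_def)
  \<comment> \<open>Different pairs of exponents may have the same sum, so the product is kept as a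
    double sum of monomials and no coefficients are collected.\<close>
  have "p x * q x = (\<Sum>m\<in>A. \<Sum>n\<in>B. (c m * d n) * (\<Prod>i\<in>UNIV. (x $ i) ^ (m i + n i)))" for x
    by (simp add: p q sum_product power_add prod.distrib mult_ac)
  then show ?thesis
    by (simp only:) (intro holomorphic_polynomials_sum holomorphic_polynomials_monomial)
qed

lemma continuous_on_holomorphic_polynomial:
  assumes "p \<in> holomorphic_polynomials"
  shows "continuous_on X p"
proof -
  obtain A c where p: "p = (\<lambda>x. \<Sum>m\<in>A. c m * (\<Prod>i\<in>UNIV. (x $ i) ^ m i))"
    using assms by (auto simp: holomorphic_polynomials_def)
  show ?thesis
    unfolding p by (intro continuous_intros)
qed

text \<open>This says that the restriction of \<open>f\<close> to \<open>X\<close> lies in P(X), the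
  uniform closure of the polynomials. Since \<open>f\<close> is a total function, the set can be
  enlarged by a single point of the hull without changing the function.\<close>

definition polynomially_approximable ::
    "(complex ^ 'n) set \<Rightarrow> (complex ^ 'n \<Rightarrow> complex) \<Rightarrow> bool" where
  "polynomially_approximable X f \<longleftrightarrow>
     (\<forall>e>0. \<exists>p\<in>holomorphic_polynomials. \<forall>x\<in>X. cmod (f x - p x) < e)"

lemma polynomially_approximable_polynomial:
  "p \<in> holomorphic_polynomials \<Longrightarrow> polynomially_approximable X p"
  unfolding polynomially_approximable_def by (auto intro!: bexI[of _ p])

lemmas polynomially_approximable_const [intro] =
  polynomially_approximable_polynomial[OF holomorphic_polynomials_const]

lemmas polynomially_approximable_nth [intro] =
  polynomially_approximable_polynomial[OF holomorphic_polynomials_nth]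

lemma polynomially_approximable_uniform_limit:
  assumes "\<And>e. e > 0 \<Longrightarrow> \<exists>g. polynomially_approximable X g \<and> (\<forall>x\<in>X. cmod (f x - g x) < e)"
  shows "polynomially_approximable X f"
  unfolding polynomially_approximable_def
proof (intro allI impI)
  fix e :: real assume "e > 0"
  then obtain g where g: "polynomially_approximable X g" "\<forall>x\<in>X. cmod (f x - g x) < e / 2"
    using assms[of "e / 2"] by auto
  then obtain p where p: "p \<in> holomorphic_polynomials" "\<forall>x\<in>X. cmod (g x - p x) < e / 2"
    using \<open>e > 0\<close> unfolding polynomially_approximable_def by (meson half_gt_zero)
  have "cmod (f x - p x) < e" if "x \<in> X" for x
    using norm_diff_triangle_less[of "f x" "g x" "e / 2" "p x" "e / 2"] g(2) p(2) that by simp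
  with p(1) show "\<exists>p\<in>holomorphic_polynomials. \<forall>x\<in>X. cmod (f x - p x) < e" by blast
qed

lemma polynomially_approximable_add [intro]:
  assumes f: "polynomially_approximable X f" and g: "polynomially_approximable X g"
  shows "polynomially_approximable X (\<lambda>x. f x + g x)"
  unfolding polynomially_approximable_def
proof (intro allI impI)
  fix e :: real assume "e > 0"
  obtain p where p: "p \<in> holomorphic_polynomials" "\<forall>x\<in>X. cmod (f x - p x) < e / 2"
    using f \<open>e > 0\<close> unfolding polynomially_approximable_def by (meson half_gt_zero)
  obtain q where q: "q \<in> holomorphic_polynomials" "\<forall>x\<in>X. cmod (g x - q x) < e / 2"
    using g \<open>e > 0\<close> unfolding polynomially_approximable_def by (meson half_gt_zero)
  have "cmod (f x + g x - (p x + q x)) < e" if "x \<in> X" for x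
  proof -
    have "cmod (f x + g x - (p x + q x)) \<le> cmod (f x - p x) + cmod (g x - q x)"
      by (rule norm_diff_triangle_ineq)
    also have "\<dots> < e / 2 + e / 2"
      using p(2) q(2) that by (intro add_strict_mono) auto
    finally show ?thesis by simp
  qed
  with holomorphic_polynomials_add[OF p(1) q(1)]
  show "\<exists>p\<in>holomorphic_polynomials. \<forall>x\<in>X. cmod (f x + g x - p x) < e"
    by (intro bexI[where x = "\<lambda>x. p x + q x"]) auto
qed

text \<open>A polynomial is continuous on the whole space, hence bounded on the compact closure of
  \<open>X\<close>; a function within distance 1 of it on \<open>X\<close> is then bounded
  too.\<close>

lemma bounded_polynomially_approximable:
  assumes "bounded X" "polynomially_approximable X f"
  shows "bounded (f ` X)"
proof -
  obtain p where p: "p \<in> holomorphic_polynomials" "\<forall>x\<in>X. cmod (f x - p x) < 1"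
    using assms(2) unfolding polynomially_approximable_def by (meson zero_less_one)
  have "compact (p ` closure X)"
    using assms(1) p(1)
    by (intro compact_continuous_image continuous_on_holomorphic_polynomial) auto
  then obtain B where B: "\<And>x. x \<in> closure X \<Longrightarrow> cmod (p x) \<le> B"
    using compact_imp_bounded bounded_iff by (metis imageI)
  show ?thesis
  proof (rule boundedI)
    fix y assume "y \<in> f ` X"
    then obtain x where x: "x \<in> X" "y = f x" by auto
    have "cmod (f x) \<le> cmod (f x - p x) + cmod (p x)"
      by (metis norm_triangle_sub add.commute)
    also have "\<dots> \<le> 1 + B"
      using p(2) B x closure_subset by (intro add_mono) (auto intro: less_imp_le)
    finally show "norm y \<le> 1 + B" using x by simp
  qed
qed

lemma polynomially_approximable_mult:
  assumes X: "bounded X"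
    and f: "polynomially_approximable X f" and g: "polynomially_approximable X g"
  shows "polynomially_approximable X (\<lambda>x. f x * g x)"
  unfolding polynomially_approximable_def
proof (intro allI impI)
  fix e :: real assume "e > 0"
  obtain M where M: "M > 0" "\<And>x. x \<in> X \<Longrightarrow> cmod (g x) \<le> M"
    using bounded_polynomially_approximable[OF X g] unfolding bounded_pos by auto
  \<comment> \<open>The order of choice matters: \<open>p\<close> depends on the bound
    \<open>M\<close> of \<open>g\<close>, and only then do the bound \<open>N\<close> of
    \<open>p\<close> and the tolerance for \<open>q\<close> become available.\<close>
  obtain p where p: "p \<in> holomorphic_polynomials" "\<forall>x\<in>X. cmod (f x - p x) < e / 2 / M"
    using f \<open>e > 0\<close> \<open>M > 0\<close> unfolding polynomially_approximable_def
    by (meson half_gt_zero divide_pos_pos)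
  obtain N where N: "N > 0" "\<And>x. x \<in> X \<Longrightarrow> cmod (p x) \<le> N"
    using bounded_polynomially_approximable[OF X polynomially_approximable_polynomial[OF p(1)]]
    unfolding bounded_pos by auto
  obtain q where q: "q \<in> holomorphic_polynomials" "\<forall>x\<in>X. cmod (g x - q x) < e / 2 / N"
    using g \<open>e > 0\<close> \<open>N > 0\<close> unfolding polynomially_approximable_def
    by (meson half_gt_zero divide_pos_pos)
  have "cmod (f x * g x - p x * q x) < e" if "x \<in> X" for x
  proof -
    have "f x * g x - p x * q x = (f x - p x) * g x + p x * (g x - q x)"
      by (simp add: algebra_simps)
    then have "cmod (f x * g x - p x * q x) \<le> cmod (f x - p x) * cmod (g x) + cmod (p x) * cmod (g x - q x)"
      by (metis norm_mult norm_triangle_ineq)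
    also have "\<dots> \<le> cmod (f x - p x) * M + N * cmod (g x - q x)"
      using M N that by (intro add_mono mult_mono) auto
    also have "\<dots> < e / 2 + e / 2"
      using p(2) q(2) M(1) N(1) that
      by (intro add_strict_mono) (auto simp: field_simps)
    finally show ?thesis by simp
  qed
  with holomorphic_polynomials_mult[OF p(1) q(1)]
  show "\<exists>p\<in>holomorphic_polynomials. \<forall>x\<in>X. cmod (f x * g x - p x) < e"
    by (intro bexI[where x = "\<lambda>x. p x * q x"]) auto
qed

lemma polynomially_approximable_diff [intro]:
  assumes X: "bounded X"
    and f: "polynomially_approximable X f" and g: "polynomially_approximable X g"
  shows "polynomially_approximable X (\<lambda>x. f x - g x)"
  using polynomially_approximable_add[OF f
      polynomially_approximable_mult[OF X polynomially_approximable_const g], of "- 1"]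
  by simp

lemma polynomially_approximable_power:
  assumes "bounded X" "polynomially_approximable X f"
  shows "polynomially_approximable X (\<lambda>x. f x ^ n)"
  by (induction n) (auto intro: polynomially_approximable_mult assms)

lemma polynomially_approximable_sum:
  assumes "\<And>j. j \<in> J \<Longrightarrow> polynomially_approximable X (f j)"
  shows "polynomially_approximable X (\<lambda>x. \<Sum>j\<in>J. f j x)"
  using assms by (induction J rule: infinite_finite_induct) auto

lemma polynomially_approximable_inverse:
  assumes X: "bounded X" and q: "polynomially_approximable X q"
    and "\<epsilon> > 0" and Re_q: "\<And>x. x \<in> X \<Longrightarrow> \<epsilon> \<le> Re (q x)"
  shows "polynomially_approximable X (\<lambda>x. inverse (q x))"
proof (rule polynomially_approximable_uniform_limit)
  fix e :: real assume "e > 0"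
  obtain M0 where M0: "\<And>x. x \<in> X \<Longrightarrow> cmod (q x) \<le> M0"
    using bounded_polynomially_approximable[OF X q] unfolding bounded_iff by auto
  \<comment> \<open>The maximum keeps \<open>M\<close> at least \<epsilon> even when
    \<open>X\<close> is empty, so that \<open>T\<close> is positive and \<epsilon> /
    \<open>T\<close> is at most 1.\<close>
  define M where "M = max M0 \<epsilon>"
  have M: "cmod (q x) \<le> M" if "x \<in> X" for x
    using M0[OF that] by (simp add: M_def)
  have "M \<ge> \<epsilon>" by (simp add: M_def)
  \<comment> \<open>This value minimises 1 - 2 \<epsilon> / \<open>T\<close> + (\<open>M\<close> /
    \<open>T\<close>)^2, the bound for the squared modulus of 1 - q / \<open>T\<close>; the minimum
    is 1 - \<epsilon> / \<open>T\<close>.\<close>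
  define T where "T = M\<^sup>2 / \<epsilon>"
  have "T > 0" using \<open>\<epsilon> > 0\<close> \<open>M \<ge> \<epsilon>\<close> by (simp add: T_def)
  have "\<epsilon> / T \<le> 1"
    using \<open>\<epsilon> > 0\<close> \<open>M \<ge> \<epsilon>\<close> by (simp add: T_def field_simps power2_eq_square mult_mono)
  define \<rho> where "\<rho> = sqrt (1 - \<epsilon> / T)"
  have \<rho>: "0 \<le> \<rho>" "\<rho> < 1"
    using \<open>\<epsilon> / T \<le> 1\<close> \<open>\<epsilon> > 0\<close> \<open>T > 0\<close> by (auto simp: \<rho>_def)
  \<comment> \<open>The values of \<open>q\<close> lie in a disc with centre \<open>T\<close> and radius less than \<open>T\<close>, on which
    \<open>1 / w\<close> is a geometric series.\<close>
  have disc: "cmod (1 - q x / T) \<le> \<rho>" if "x \<in> X" for x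
  proof -
    have "(cmod (1 - q x / T))\<^sup>2 = 1 - 2 * Re (q x) / T + (cmod (q x))\<^sup>2 / T\<^sup>2"
    proof -
      have "(cmod (1 - v))\<^sup>2 = 1 - 2 * Re v + (cmod v)\<^sup>2" for v
        unfolding cmod_power2 by (simp add: power2_eq_square algebra_simps)
      from this[of "q x / T"] show ?thesis
        using \<open>T > 0\<close> by (simp add: norm_divide power_divide)
    qed
    also have "\<dots> \<le> 1 - 2 * \<epsilon> / T + M\<^sup>2 / T\<^sup>2"
      using Re_q[OF that] M[OF that] \<open>T > 0\<close>
      by (intro add_mono diff_mono divide_right_mono power_mono) auto
    also have "M\<^sup>2 / T\<^sup>2 = \<epsilon> / T"
      using \<open>\<epsilon> > 0\<close> \<open>M \<ge> \<epsilon>\<close> by (simp add: T_def field_simps power2_eq_square)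
    finally show ?thesis
      unfolding \<rho>_def by (intro real_le_rsqrt) simp
  qed
  obtain n where n: "\<rho> ^ n < e * \<epsilon>"
    using real_arch_pow_inv[of "e * \<epsilon>" \<rho>] \<rho> \<open>e > 0\<close> \<open>\<epsilon> > 0\<close> by auto
  define s where "s = (\<lambda>x. (1 / of_real T) * (\<Sum>k<n. (1 - (1 / of_real T) * q x) ^ k))"
  have "polynomially_approximable X s"
    unfolding s_def
    by (intro polynomially_approximable_mult[OF X] polynomially_approximable_sum
        polynomially_approximable_power[OF X] polynomially_approximable_diff[OF X]
        polynomially_approximable_const q)
  moreover have "cmod (inverse (q x) - s x) < e" if "x \<in> X" for x
  proof -
    have "cmod (q x) \<ge> \<epsilon>"
      using Re_q[OF that] complex_Re_le_cmod[of "q x"] by linarith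
    then have "q x \<noteq> 0" using \<open>\<epsilon> > 0\<close> by auto
    define v where "v = 1 - q x / T"
    have "v \<noteq> 1" using \<open>q x \<noteq> 0\<close> \<open>T > 0\<close> by (auto simp: v_def)
    have "s x = (1 / T) * (\<Sum>k<n. v ^ k)"
      by (simp add: s_def v_def)
    also have "\<dots> = (1 / T) * ((1 - v ^ n) / (1 - v))"
      using \<open>v \<noteq> 1\<close> by (simp add: sum_gp_strict)
    also have "\<dots> = (1 - v ^ n) / q x"
      using \<open>T > 0\<close> by (simp add: v_def)
    finally have "inverse (q x) - s x = v ^ n / q x"
      using \<open>q x \<noteq> 0\<close> by (simp add: field_simps)
    then have "cmod (inverse (q x) - s x) = cmod v ^ n / cmod (q x)"
      by (simp add: norm_divide norm_power)
    also have "\<dots> \<le> \<rho> ^ n / \<epsilon>"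
      using disc[OF that] \<open>cmod (q x) \<ge> \<epsilon>\<close> \<open>\<epsilon> > 0\<close> \<rho> 
      by (intro frac_le power_mono) (auto simp: v_def)
    also have "\<dots> < e"
      using n \<open>\<epsilon> > 0\<close> by (simp add: field_simps)
    finally show ?thesis .
  qed
  ultimately show "\<exists>g. polynomially_approximable X g \<and> (\<forall>x\<in>X. cmod (inverse (q x) - g x) < e)"
    by blast
qed

section \<open>Polynomial hulls of compact sets and of graphs\<close>

lemma subset_polynomial_hull:
  assumes "compact X"
  shows "X \<subseteq> polynomial_hull X"
proof -
  have "cmod (p x) \<le> (SUP y\<in>X. cmod (p y))" if "x \<in> X" "p \<in> holomorphic_polynomials" for x p
  proof (rule cSUP_upper[OF that(1)])
    have "compact ((\<lambda>y. cmod (p y)) ` X)"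
      using assms continuous_on_holomorphic_polynomial[OF that(2)]
      by (intro compact_continuous_image continuous_on_norm)
    then show "bdd_above ((\<lambda>y. cmod (p y)) ` X)"
      by (intro bounded_imp_bdd_above compact_imp_bounded)
  qed
  then show ?thesis by (auto simp: polynomial_hull_def)
qed

text \<open>The inequality that defines the hull survives uniform limits as long as the polynomials
  also converge at the hull point, which is why the approximation is required on
  \<open>insert x X\<close>.\<close>

lemma polynomial_hull_approximable_le:
  assumes x: "x \<in> polynomial_hull X" and "X \<noteq> {}"
    and f: "polynomially_approximable (insert x X) f"
    and B: "\<And>y. y \<in> X \<Longrightarrow> cmod (f y) \<le> B"
  shows "cmod (f x) \<le> B"
proof (rule field_le_epsilon)
  fix e :: real assume "e > 0"
  then obtain p where p: "p \<in> holomorphic_polynomials" "\<forall>y\<in>insert x X. cmod (f y - p y) < e / 2"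
    using f unfolding polynomially_approximable_def by (meson half_gt_zero)
  have "cmod (p y) \<le> B + e / 2" if "y \<in> X" for y
  proof -
    have "cmod (p y) \<le> cmod (f y) + cmod (f y - p y)"
      by (metis norm_triangle_sub norm_minus_commute)
    then show ?thesis using B[OF that] p(2) that by fastforce
  qed
  then have "cmod (p x) \<le> B + e / 2"
    using x p(1) cSUP_least[OF \<open>X \<noteq> {}\<close>, of "\<lambda>y. cmod (p y)" "B + e / 2"]
    unfolding polynomial_hull_def by fastforce
  moreover have "cmod (f x) \<le> cmod (p x) + cmod (f x - p x)"
    by (rule norm_triangle_sub)
  moreover have "cmod (f x - p x) < e / 2"
    using p(2) by simp
  ultimately show "cmod (f x) \<le> B + e" by linarith
qed

lemma graph_over_eq_image: "graph_over S F = (\<lambda>z. vector [z, F z]) ` S"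
  by (auto simp: graph_over_def)

lemma compact_graph_over:
  assumes "compact S" "continuous_on S F"
  shows "compact (graph_over S F)"
proof -
  \<comment> \<open>Writing \<open>vector\<close> as a lambda over the index makes continuity a
    componentwise question; for the index type \<open>2\<close> the else branch is the second
    coordinate.\<close>
  have "continuous_on S (\<lambda>z. \<chi> i. if i = 1 then z else F z :: complex ^ 2)"
  proof (rule continuous_on_vec_lambda)
    show "continuous_on S (\<lambda>z. if i = 1 then z else F z)" for i :: 2
      using assms(2) by (cases "i = 1") auto
  qed
  also have "(\<lambda>z. \<chi> i. if i = 1 then z else F z :: complex ^ 2) = (\<lambda>z. vector [z, F z])"
    by (auto simp: fun_eq_iff vec_eq_iff forall_2)
  finally show ?thesis
    unfolding graph_over_eq_image by (intro compact_continuous_image assms(1))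
qed

text \<open>The test function (w - F z0) / (1 + n P) keeps its numerator as value at
  \<open>x\<close>, where \<open>P\<close> vanishes. On the graph it is small near \<open>z0\<close>
  by continuity of \<open>F\<close>, and elsewhere because n P dominates the numerator.\<close>

lemma polynomial_hull_graph_over:
  assumes "compact S" and F: "continuous_on S F"
    and x: "x \<in> polynomial_hull (graph_over S F)" and z0: "x $ 1 \<in> S"
    and "cmod C = 1"
    and Re: "\<And>z. z \<in> S \<Longrightarrow> 0 \<le> Re (C * ((z - x $ 1) * (F z - F (x $ 1))))"
  shows "x \<in> graph_over S F"
proof -
  define X where "X = graph_over S F"
  define z0 where "z0 = x $ 1"
  have "z0 \<in> S" using z0 by (simp add: z0_def)
  then have "X \<noteq> {}" by (auto simp: X_def graph_over_def)
  have "bounded (insert x X)"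
    using compact_graph_over[OF \<open>compact S\<close> F] by (simp add: X_def compact_imp_bounded)
  define P where "P = (\<lambda>y::complex ^ 2. C * ((y $ 1 - z0) * (y $ 2 - F z0)))"
  have "cmod (x $ 2 - F z0) \<le> e" if "e > 0" for e
  proof -
    obtain d where "d > 0" and d: "\<And>z. z \<in> S \<Longrightarrow> dist z z0 < d \<Longrightarrow> dist (F z) (F z0) < e"
      using F \<open>z0 \<in> S\<close> \<open>e > 0\<close> unfolding continuous_on_iff by metis
    \<comment> \<open>With this \<open>n\<close>, any z at distance at least \<open>d\<close> from
      \<open>z0\<close> satisfies n |P| >= |F z - F z0| / e.\<close>
    define n where "n = 1 / (e * d)"
    have "n > 0" using \<open>e > 0\<close> \<open>d > 0\<close> by (simp add: n_def)
    define q where "q = (\<lambda>y. 1 + of_real n * P y)"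
    \<comment> \<open>The hull point is not yet known to lie on the graph, but its first coordinate
      is \<open>z0\<close>, so \<open>P\<close> is zero there and the half plane condition extends
      to it.\<close>
    have ReP: "0 \<le> Re (P y)" if "y \<in> insert x X" for y
    proof (cases "y = x")
      case False
      with that obtain z where "z \<in> S" "y $ 1 = z" "y $ 2 = F z"
        by (auto simp: X_def graph_over_def)
      with Re[of z] show ?thesis by (simp add: P_def z0_def)
    qed (simp add: P_def z0_def)
    have "polynomially_approximable (insert x X) (\<lambda>y. (y $ 2 - F z0) * inverse (q y))"
    proof (intro polynomially_approximable_mult polynomially_approximable_inverse[where \<epsilon> = 1])
      show "polynomially_approximable (insert x X) q"
        unfolding q_def P_def using \<open>bounded (insert x X)\<close>
        by (intro polynomially_approximable_mult polynomially_approximable_add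
            polynomially_approximable_diff) auto
      show "1 \<le> Re (q y)" if "y \<in> insert x X" for y
        using ReP[OF that] \<open>n > 0\<close> by (simp add: q_def)
    qed (use \<open>bounded (insert x X)\<close> in auto)
    then have "cmod ((x $ 2 - F z0) * inverse (q x)) \<le> e"
    proof (rule polynomial_hull_approximable_le[OF x[folded X_def] \<open>X \<noteq> {}\<close>])
      fix y assume "y \<in> X"
      then obtain z where z: "z \<in> S" "y $ 1 = z" "y $ 2 = F z"
        by (auto simp: X_def graph_over_def)
      have "1 \<le> Re (q y)"
        using ReP[of y] \<open>y \<in> X\<close> \<open>n > 0\<close> by (simp add: q_def)
      then have "1 \<le> cmod (q y)"
        using complex_Re_le_cmod[of "q y"] by linarith
      have "cmod (F z - F z0) \<le> e * cmod (q y)"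
      proof (cases "dist z z0 < d")
        case True
        then have "cmod (F z - F z0) \<le> e"
          using d[OF z(1)] by (simp add: dist_norm less_imp_le)
        also have "e \<le> e * cmod (q y)"
          using \<open>1 \<le> cmod (q y)\<close> \<open>e > 0\<close> by simp
        finally show ?thesis .
      next
        case False
        \<comment> \<open>Adding 1 to a number with nonnegative real part does not decrease its
          modulus.\<close>
        have "cmod (of_real n * P y) \<le> cmod (q y)"
        proof (rule power2_le_imp_le)
          have "0 \<le> n * Re (P y)" using ReP[of y] \<open>y \<in> X\<close> \<open>n > 0\<close> by simp
          then show "(cmod (of_real n * P y))\<^sup>2 \<le> (cmod (q y))\<^sup>2"
            unfolding cmod_power2 q_def by (simp add: power2_eq_square algebra_simps)
        qed simp
        moreover have "cmod (of_real n * P y) = n * (dist z z0 * cmod (F z - F z0))"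
          using \<open>n > 0\<close> \<open>cmod C = 1\<close> by (simp add: P_def z norm_mult dist_norm)
        moreover have "n * (d * cmod (F z - F z0)) \<le> n * (dist z z0 * cmod (F z - F z0))"
          using False \<open>n > 0\<close> by (intro mult_left_mono mult_right_mono) auto
        moreover have "n * (d * cmod (F z - F z0)) = cmod (F z - F z0) / e"
          using \<open>d > 0\<close> by (simp add: n_def)
        ultimately have "cmod (F z - F z0) / e \<le> cmod (q y)"
          by linarith
        then show ?thesis
          using \<open>e > 0\<close> by (simp add: field_simps)
      qed
      moreover have "0 < cmod (q y)" using \<open>1 \<le> cmod (q y)\<close> by linarith
      ultimately show "cmod ((y $ 2 - F z0) * inverse (q y)) \<le> e"
        using z
        by (simp add: norm_divide pos_divide_le_eq flip: divide_inverse)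
    qed
    moreover have "q x = 1" by (simp add: q_def P_def z0_def)
    ultimately show ?thesis by simp
  qed
  then have "x $ 2 = F z0"
    using field_le_epsilon[of "cmod (x $ 2 - F z0)" 0] by simp
  then have "x = vector [z0, F z0]"
    by (simp add: vec_eq_iff forall_2 z0_def)
  then show ?thesis
    using \<open>z0 \<in> S\<close> by (auto simp: graph_over_def)
qed

lemma polynomially_convex_graph_over_cball:
  assumes "0 \<le> r" and F: "continuous_on (cball 0 r) F"
    and C: "\<And>\<zeta>. \<zeta> \<in> cball 0 r \<Longrightarrow>
      \<exists>C. cmod C = 1 \<and> (\<forall>z\<in>cball 0 r. 0 \<le> Re (C * ((z - \<zeta>) * (F z - F \<zeta>))))"
  shows "polynomially_convex (graph_over (cball 0 r) F)"
proof -
  let ?X = "graph_over (cball 0 r) F"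
  have "compact ?X" using F by (intro compact_graph_over) auto
  moreover have "x \<in> ?X" if x: "x \<in> polynomial_hull ?X" for x
  proof -
    \<comment> \<open>The first coordinate is itself a polynomial and is bounded by \<open>r\<close>
      on the graph, so every hull point lies over the disc.\<close>
    have "cmod (x $ 1) \<le> r"
      using assms(1)
      by (intro polynomial_hull_approximable_le[OF x _ polynomially_approximable_nth])
        (auto simp: graph_over_def intro: exI[of _ 0])
    then have "x $ 1 \<in> cball 0 r" by simp
    from C[OF this] show ?thesis
      using polynomial_hull_graph_over[OF _ F x \<open>x $ 1 \<in> cball 0 r\<close>] by auto
  qed
  ultimately show ?thesis
    unfolding polynomially_convex_def using subset_polynomial_hull by blast
qed

section \<open>The Cauchy kernel on a disc\<close>

lemma Basis_real_vec: "(Basis :: (real ^ 'n) set) = (\<lambda>i. axis i 1) ` UNIV"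
  by (auto simp: Basis_vec_def)

text \<open>The two measures agree on boxes. This carries measure computations for orthogonal maps
  of \<open>real ^ 2\<close> over to the complex plane.\<close>

lemma distr_lborel_Complex:
  "distr lborel borel (\<lambda>v::real ^ 2. Complex (v $ 1) (v $ 2)) = lborel"
proof (rule lborel_eqI[symmetric])
  fix l u :: complex
  assume le: "\<And>b. b \<in> Basis \<Longrightarrow> l \<bullet> b \<le> u \<bullet> b"
  let ?l = "vector [Re l, Im l] :: real ^ 2" and ?u = "vector [Re u, Im u] :: real ^ 2"
  have "(\<lambda>v. Complex (v $ 1) (v $ 2)) -` box l u = box ?l ?u"
    by (auto simp: box_def Basis_real_vec inner_axis UNIV_2 Basis_complex_def)
  moreover have "emeasure lborel (box ?l ?u) = ennreal (\<Prod>b\<in>Basis. (?u - ?l) \<bullet> b)"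
    using le[of 1] le[of \<i>] by (intro emeasure_lborel_box)
      (auto simp: Basis_real_vec inner_axis Basis_complex_def image_iff exhaust_2 UNIV_2)
  moreover have "(\<Prod>b\<in>Basis. (?u - ?l) \<bullet> b) = (\<Prod>b\<in>Basis. (u - l) \<bullet> b)"
    unfolding Basis_real_vec
    by (subst prod.reindex) (auto simp: inj_on_def axis_eq_axis UNIV_2 inner_axis Basis_complex_def)
  moreover have "(\<lambda>v::real ^ 2. Complex (v $ 1) (v $ 2)) \<in> borel_measurable borel"
    unfolding Complex_eq by (intro borel_measurable_continuous_onI continuous_intros)
  ultimately show "emeasure (distr lborel borel (\<lambda>v::real ^ 2. Complex (v $ 1) (v $ 2))) (box l u)
      = ennreal (\<Prod>b\<in>Basis. (u - l) \<bullet> b)"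
    by (subst emeasure_distr) auto
qed simp

lemma distr_lborel_mult_unit:
  fixes c :: complex
  assumes "cmod c = 1"
  shows "distr lborel borel ((*) c) = lborel"
proof (rule lborel_eqI[symmetric])
  fix l u :: complex
  assume le: "\<And>b. b \<in> Basis \<Longrightarrow> l \<bullet> b \<le> u \<bullet> b"
  define \<phi> where "\<phi> v = Complex (v $ 1) (v $ 2)" for v :: "real ^ 2"
  define \<psi> where "\<psi> w = (vector [Re w, Im w] :: real ^ 2)" for w
  \<comment> \<open>In real coordinates \<open>g\<close> is multiplication by \<open>cnj c\<close>,
    the inverse of multiplication by \<open>c\<close>; preimages under the latter thus become images
    under an orthogonal map.\<close>
  define g where "g v = \<psi> (cnj c * \<phi> v)" for v
  have [simp]: "\<phi> (\<psi> w) = w" "\<psi> (\<phi> v) = v" for v w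
    by (auto simp: \<phi>_def \<psi>_def vec_eq_iff forall_2)
  have [measurable]: "\<phi> \<in> borel_measurable borel"
    unfolding \<phi>_def Complex_eq by (intro borel_measurable_continuous_onI continuous_intros)
  have emeasure_\<phi>: "emeasure lborel A = emeasure lborel (\<phi> -` A)" if "A \<in> sets borel" for A
    using arg_cong[OF distr_lborel_Complex[folded \<phi>_def], of "\<lambda>M. emeasure M A"] that
    by (simp add: emeasure_distr)
  have norm_\<psi>: "norm (\<psi> w) = cmod w" for w
    by (simp add: \<psi>_def norm_vec_def L2_set_def UNIV_2 cmod_def)
  have norm_\<phi>: "cmod (\<phi> v) = norm v" for v
    using norm_\<psi>[of "\<phi> v"] by simp
  have "linear g"
    by (rule linearI)
      (auto simp: g_def \<phi>_def \<psi>_def vec_eq_iff forall_2 algebra_simps)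
  then have orth: "orthogonal_transformation g"
    using assms by (simp add: orthogonal_transformation g_def norm_\<psi> norm_\<phi> norm_mult)
  have cnj_c: "cnj c * c = 1"
    using assms by (simp add: mult.commute complex_norm_square[symmetric])
  define B where "B = \<phi> -` box l u"
  have "open B"
    unfolding B_def \<phi>_def Complex_eq
    by (rule open_vimage) (auto intro!: continuous_intros open_box)
  then have [measurable]: "B \<in> sets borel" by auto
  have finB: "emeasure lborel B = emeasure lborel (box l u)"
    by (simp add: emeasure_\<phi> B_def)
  have "emeasure lborel B < \<infinity>"
    using emeasure_lborel_box_finite[of l u] by (simp add: finB)
  then have lmB: "B \<in> lmeasurable"
    by (simp add: fmeasurable_def)
  have vim: "\<phi> -` ((*) c -` box l u) = g ` B"
  proof (intro set_eqI iffI)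
    fix v assume v: "v \<in> \<phi> -` ((*) c -` box l u)"
    then have "\<psi> (c * \<phi> v) \<in> B" by (simp add: B_def)
    moreover have "v = g (\<psi> (c * \<phi> v))"
      using cnj_c by (simp add: g_def mult.assoc[symmetric])
    ultimately show "v \<in> g ` B" by blast
  next
    fix v assume "v \<in> g ` B"
    then show "v \<in> \<phi> -` ((*) c -` box l u)"
      using cnj_c by (auto simp: g_def B_def mult.assoc[symmetric] mult.commute[of c "cnj c"])
  qed
  have "(\<lambda>v. c * \<phi> v) -` box l u \<in> sets borel"
    using measurable_sets[of "\<lambda>v. c * \<phi> v" borel borel "box l u"] by simp
  then have gB [measurable]: "g ` B \<in> sets borel"
    unfolding vim[symmetric] by (simp add: vimage_def)
  have "emeasure (distr lborel borel ((*) c)) (box l u) = emeasure lborel ((*) c -` box l u)"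
    by (simp add: emeasure_distr)
  also have "\<dots> = emeasure lborel (\<phi> -` ((*) c -` box l u))"
    using measurable_sets[of "(*) c" borel borel "box l u"] by (intro emeasure_\<phi>) simp
  also have "\<dots> = emeasure lebesgue (g ` B)"
    by (simp add: vim)
  also have "\<dots> = ennreal (measure lebesgue (g ` B))"
    by (intro emeasure_eq_measure2 measurable_orthogonal_image orth lmB)
  also have "\<dots> = ennreal (measure lebesgue B)"
    using measure_orthogonal_image[OF orth lmB] by simp
  also have "\<dots> = emeasure lebesgue B"
    by (intro emeasure_eq_measure2[symmetric] lmB)
  also have "\<dots> = emeasure lborel (box l u)"
    by (simp add: finB)
  finally show "emeasure (distr lborel borel ((*) c)) (box l u) = ennreal (\<Prod>b\<in>Basis. (u - l) \<bullet> b)"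
    using le by (simp add: emeasure_lborel_box)
qed simp

section \<open>Integrability of the kernel\<close>

text \<open>On the annulus R / 2^(n+1) < |w| <= R / 2^n the function 1 / |w| is at most 2^(n+1) / R.
  Replacing each annulus by the full disc of radius R / 2^n gives integrals 2 pi R / 2^n, which form
  a convergent series.\<close>

lemma integrable_inverse_norm_cball:
  "integrable lborel (\<lambda>w::complex. indicator (cball 0 R) w / cmod w)"
proof (cases "R > 0")
  case False
  have "(\<lambda>w::complex. indicator (cball 0 R) w / cmod w) = (\<lambda>_. 0)"
    using False by (auto simp: fun_eq_iff indicator_def) (meson norm_le_zero_iff not_less order_trans)
  then show ?thesis by simp
next
  case True
  let ?f = "\<lambda>w::complex. indicator (cball 0 R) w / cmod w"
  let ?g = "\<lambda>n (w::complex). ennreal (2 ^ Suc n / R) * indicator (cball 0 (R / 2 ^ n)) w"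
  have le: "ennreal (norm (?f w)) \<le> (\<Sum>n. ?g n w)" for w
  \<comment> \<open>At the origin division by zero makes \<open>?f\<close> vanish, so only the
    punctured disc needs an estimate.\<close>
  proof (cases "w \<noteq> 0 \<and> cmod w \<le> R")
    case True
    then have w: "w \<noteq> 0" "cmod w \<le> R" by auto
    have "\<exists>n. R * (1 / 2) ^ Suc n < cmod w"
    proof -
      obtain n where "(1 / 2) ^ n < cmod w / R"
        using real_arch_pow_inv[of "cmod w / R" "1 / 2"] w \<open>R > 0\<close> by auto
      then have "R * (1 / 2) ^ n < cmod w"
        using \<open>R > 0\<close> by (simp add: field_simps)
      moreover have "R * (1 / 2) ^ Suc n \<le> R * (1 / 2) ^ n"
        using \<open>R > 0\<close> by simp
      ultimately show ?thesis by (meson le_less_trans)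
    qed
    \<comment> \<open>Minimality of \<open>n\<close> gives the upper bound for |w|; when
      \<open>n\<close> is 0 that bound is |w| <= \<open>R\<close> itself.\<close>
    then obtain n where n: "R * (1 / 2) ^ Suc n < cmod w"
      and least: "\<And>m. m < n \<Longrightarrow> \<not> R * (1 / 2) ^ Suc m < cmod w"
      using exists_least_iff[of "\<lambda>n. R * (1 / 2) ^ Suc n < cmod w"] by blast
    have "cmod w \<le> R * (1 / 2) ^ n"
      using w least[of "n - 1"] by (cases n) auto
    then have in_ball: "w \<in> cball 0 (R / 2 ^ n)"
      by (simp add: power_one_over field_simps)
    have "1 / cmod w \<le> 2 ^ Suc n / R"
      using n w \<open>R > 0\<close> by (simp add: power_one_over field_simps)
    then have "ennreal (norm (?f w)) \<le> ?g n w"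
      using w in_ball by (simp add: ennreal_leI)
    also have "\<dots> \<le> (\<Sum>n. ?g n w)"
    proof -
      have "(\<Sum>k\<in>{n}. ?g k w) \<le> (\<Sum>n. ?g n w)"
        by (rule sum_le_suminf) auto
      then show ?thesis
        by (simp only: sum.insert sum.empty finite.emptyI empty_iff not_False_eq_True add_0_right)
    qed
    finally show ?thesis .
  qed (auto simp: indicator_def)
  have "(\<integral>\<^sup>+w. ennreal (norm (?f w)) \<partial>lborel) \<le> (\<integral>\<^sup>+w. (\<Sum>n. ?g n w) \<partial>lborel)"
    using le by (intro nn_integral_mono)
  also have "\<dots> = (\<Sum>n. \<integral>\<^sup>+w. ?g n w \<partial>lborel)"
    by (intro nn_integral_suminf borel_measurable_times_ennreal borel_measurable_const
        borel_measurable_indicator) simp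
  also have "\<dots> = (\<Sum>n. ennreal (2 * pi * R * (1 / 2) ^ n))"
  proof (rule suminf_cong)
    fix n
    have "(\<integral>\<^sup>+w. ?g n w \<partial>lborel)
        = ennreal (2 ^ Suc n / R) * ennreal (pi * (R / 2 ^ n) ^ 2)"
      using \<open>R > 0\<close> by (simp add: nn_integral_cmult_indicator emeasure_cball unit_ball_vol_2)
    also have "\<dots> = ennreal (2 * pi * R * (1 / 2) ^ n)"
      using \<open>R > 0\<close>
      by (simp add: ennreal_mult[symmetric] power2_eq_square power_one_over field_simps)
    finally show "(\<integral>\<^sup>+w. ?g n w \<partial>lborel) = ennreal (2 * pi * R * (1 / 2) ^ n)" .
  qed
  also have "\<dots> < \<infinity>"
    using \<open>R > 0\<close>
    by (subst suminf_ennreal2) (auto intro!: summable_mult summable_geometric)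
  finally show ?thesis
    by (intro integrableI_bounded borel_measurable_divide borel_measurable_indicator
        borel_measurable_norm) auto
qed

text \<open>Translating by \<open>z\<close> moves the singularity to the origin and the disc into
  the disc of radius \<open>r + cmod z\<close>.\<close>

lemma integrable_Cauchy_kernel_cball:
  fixes z :: complex
  shows "integrable lborel (\<lambda>\<zeta>. indicator (cball 0 r) \<zeta> / cmod (z - \<zeta>))"
proof -
  let ?f = "\<lambda>w::complex. indicator (cball 0 (r + cmod z)) w / cmod w"
  have int: "integrable (distr lborel borel ((+) (- z))) ?f"
    using integrable_inverse_norm_cball by (simp only: lborel_distr_plus)
  have meas: "(\<lambda>\<zeta>. indicat_real (cball 0 r) \<zeta> / cmod (z - \<zeta>)) \<in> borel_measurable borel"
    by (intro borel_measurable_divide borel_measurable_indicator borel_measurable_continuous_onI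
        continuous_intros) simp
  have "integrable lborel (\<lambda>\<zeta>. ?f (- z + \<zeta>))"
    using int by (rule integrable_distr[rotated]) simp
  then show ?thesis
  proof (rule Bochner_Integration.integrable_bound)
    show "AE \<zeta> in lborel. norm (indicator (cball 0 r) \<zeta> / cmod (z - \<zeta>)) \<le> norm (?f (- z + \<zeta>))"
    proof (rule AE_I2)
      fix \<zeta>
      have "cmod (- z + \<zeta>) \<le> r + cmod z" if "cmod \<zeta> \<le> r"
        using norm_triangle_ineq[of "- z" \<zeta>] that by simp
      moreover have "cmod (- z + \<zeta>) = cmod (z - \<zeta>)"
        by (metis norm_minus_commute diff_conv_add_uminus add.commute)
      ultimately show "norm (indicator (cball 0 r) \<zeta> / cmod (z - \<zeta>)) \<le> norm (?f (- z + \<zeta>))"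
        by (auto simp: indicator_def)
    qed
  qed (use meas in simp)
qed

section \<open>Means of the Cauchy kernel over circles\<close>

text \<open>This is Cauchy's formula at the centre of the unit circle: the derivative of the
  parametrisation cancels the denominator up to the factor 2 pi i.\<close>

lemma circle_mean_value:
  assumes "f holomorphic_on cball 0 1"
  shows "((\<lambda>t. f (cis (2 * pi * t))) has_integral f 0) {0..1}"
proof -
  have "((\<lambda>u. f u / (u - 0)) has_contour_integral (2 * of_real pi * \<i> * f 0)) (circlepath 0 1)"
    using assms by (intro Cauchy_integral_circlepath_simple) auto
  then have "((\<lambda>t. (2 * of_real pi * \<i>) * f (cis (2 * pi * t))) has_integral
      (2 * of_real pi * \<i>) * f 0) {0..1}"
    unfolding has_contour_integral_def
  proof (rule has_integral_eq[rotated])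
    fix t :: real assume "t \<in> {0..1}"
    moreover have "circlepath 0 1 t = cis (2 * pi * t)"
      by (simp add: circlepath cis_conv_exp mult_ac)
    moreover have "exp (2 * of_real pi * \<i> * t) = cis (2 * pi * t)"
      by (simp add: cis_conv_exp mult_ac)
    ultimately show "f (circlepath 0 1 t) / (circlepath 0 1 t - 0)
        * vector_derivative (circlepath 0 1) (at t within {0..1})
        = 2 * of_real pi * \<i> * f (cis (2 * pi * t))"
      by (simp add: vector_derivative_circlepath01)
  qed
  from has_integral_mult_right[OF this, of "inverse (2 * of_real pi * \<i>)"]
  show ?thesis by (simp add: field_simps)
qed

text \<open>As a function of w the quotient 1 / (z - w \<zeta>) has no pole in the closed unit disc,
  so its mean is the value at w = 0.\<close>

lemma circle_mean_Cauchy_kernel_inside: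
  assumes "cmod \<zeta> < cmod z"
  shows "((\<lambda>t. 1 / (z - cis (2 * pi * t) * \<zeta>)) has_integral 1 / z) {0..1}"
proof -
  have "z - w * \<zeta> \<noteq> 0" if "cmod w \<le> 1" for w
  proof
    assume "z - w * \<zeta> = 0"
    then have "cmod z = cmod w * cmod \<zeta>" by (simp add: norm_mult)
    also have "\<dots> \<le> cmod \<zeta>" using that by (simp add: mult_left_le_one_le)
    finally show False using assms by simp
  qed
  then have "(\<lambda>w. 1 / (z - w * \<zeta>)) holomorphic_on cball 0 1"
    by (intro holomorphic_intros) auto
  from circle_mean_value[OF this] show ?thesis by simp
qed

text \<open>Here 1 / (z - w \<zeta>) has its pole inside the unit disc. On the unit circle
  \<open>cnj w\<close> is 1 / w, so the conjugate of the integrand equals w / (w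
  \<open>cnj z\<close> - \<open>cnj\<close> \<zeta>), which is holomorphic on the closed disc and
  vanishes at 0.\<close>

lemma circle_mean_Cauchy_kernel_outside:
  assumes "cmod z < cmod \<zeta>"
  shows "((\<lambda>t. 1 / (z - cis (2 * pi * t) * \<zeta>)) has_integral 0) {0..1}"
proof -
  have "w * cnj z - cnj \<zeta> \<noteq> 0" if "cmod w \<le> 1" for w
  proof
    assume "w * cnj z - cnj \<zeta> = 0"
    then have "cmod \<zeta> = cmod w * cmod z" by (metis complex_mod_cnj eq_iff_diff_eq_0 norm_mult)
    also have "\<dots> \<le> cmod z" using that by (simp add: mult_left_le_one_le)
    finally show False using assms by simp
  qed
  then have "(\<lambda>w. w / (w * cnj z - cnj \<zeta>)) holomorphic_on cball 0 1"
    by (intro holomorphic_intros) auto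
  from has_integral_cnj[THEN iffD2, OF circle_mean_value[OF this]]
  have "((\<lambda>t. cnj (cis (2 * pi * t) / (cis (2 * pi * t) * cnj z - cnj \<zeta>))) has_integral 0) {0..1}"
    by (simp add: o_def)
  moreover have "cnj (cis t / (cis t * cnj z - cnj \<zeta>)) = 1 / (z - cis t * \<zeta>)" for t
  proof -
    have c: "cis t * cis (- t) = 1" by (simp add: cis_mult)
    have "cnj (cis t / (cis t * cnj z - cnj \<zeta>)) = cis (- t) / (cis (- t) * z - \<zeta>)"
      by (simp add: cis_cnj)
    also have "\<dots> = (cis t * cis (- t)) / (cis t * (cis (- t) * z - \<zeta>))"
      by simp
    also have "\<dots> = 1 / (z - cis t * \<zeta>)"
      using c by (simp add: right_diff_distrib mult.assoc[symmetric])
    finally show ?thesis .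
  qed
  ultimately show ?thesis by simp
qed


text \<open>The kernel \<open>g\<close> is arbitrary because the identity is applied both to 1 / w
  and to its modulus.\<close>

lemma integral_Cauchy_kernel_rotate:
  fixes z c :: complex and g :: "complex \<Rightarrow> 'a :: euclidean_space"
  assumes "cmod c = 1" and g: "g \<in> borel_measurable borel"
  shows "(LBINT \<zeta>. indicator (cball 0 r) \<zeta> *\<^sub>R g (z - c * \<zeta>)) =
    (LBINT \<zeta>. indicator (cball 0 r) \<zeta> *\<^sub>R g (z - \<zeta>))"
proof -
  have [measurable]: "cball (0::complex) r \<in> sets borel" by simp
  have [measurable]: "(\<lambda>\<zeta>. z - \<zeta>) \<in> borel_measurable borel"
    by (intro borel_measurable_continuous_onI continuous_intros)
  have "(\<lambda>\<zeta>. indicat_real (cball 0 r) \<zeta> *\<^sub>R g (z - \<zeta>)) \<in> borel_measurable borel"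
    by (intro borel_measurable_scaleR borel_measurable_indicator measurable_compose[OF _ g]) auto
  then have "(LBINT \<zeta>. indicator (cball 0 r) (c * \<zeta>) *\<^sub>R g (z - c * \<zeta>)) =
      (\<integral>\<zeta>. indicator (cball 0 r) \<zeta> *\<^sub>R g (z - \<zeta>) \<partial>distr lborel borel ((*) c))"
    by (subst integral_distr) auto
  moreover have "indicator (cball 0 r) (c * \<zeta>) = (indicator (cball 0 r) \<zeta> :: real)" for \<zeta>
    using assms by (simp add: indicator_def norm_mult)
  ultimately show ?thesis
    using assms by (simp add: distr_lborel_mult_unit)
qed

text \<open>By rotation invariance the kernel may be averaged over circles; the average of
  \<open>1 / (z - \<zeta>)\<close> over the circle through \<open>\<zeta>\<close> is \<open>1 / z\<close> or \<open>0\<close>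
  according to whether \<open>z\<close> lies outside or inside.\<close>

lemma integral_Cauchy_kernel_cball:
  fixes z :: complex
  assumes z: "z \<in> cball 0 r"
  shows "(LBINT \<zeta>. indicator (cball 0 r) \<zeta> *\<^sub>R (1 / (z - \<zeta>))) = pi * cnj z"
proof -
  define D :: "complex set" where "D = cball 0 r"
  have [measurable]: "D \<in> sets borel" by (simp add: D_def)
  define f where "f = (\<lambda>t \<zeta>. indicator {0..1::real} t *\<^sub>R
    (indicator D \<zeta> *\<^sub>R (1 / (z - cis (2 * pi * t) * \<zeta>))))"
  define I where "I = (LBINT \<zeta>. indicator D \<zeta> *\<^sub>R (1 / (z - \<zeta>)))"
  have [measurable]: "(\<lambda>t. cis (2 * pi * t)) \<in> borel_measurable borel"
    by (intro borel_measurable_continuous_onI continuous_intros)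
  have meas_f: "case_prod f \<in> borel_measurable (lborel \<Otimes>\<^sub>M lborel)"
    unfolding f_def by measurable
  have rot: "(LBINT \<zeta>. f t \<zeta>) = indicator {0..1} t *\<^sub>R I" for t
    unfolding f_def I_def D_def
    using integral_Cauchy_kernel_rotate[of "cis (2 * pi * t)" "\<lambda>w. 1 / w" r z]
    by (cases "t \<in> {0..1}") auto
  have norm_f: "(LBINT \<zeta>. norm (f t \<zeta>)) =
      indicator {0..1} t * (LBINT \<zeta>. indicator D \<zeta> / cmod (z - \<zeta>))" for t
    unfolding f_def D_def
    using integral_Cauchy_kernel_rotate[of "cis (2 * pi * t)" "\<lambda>w. 1 / cmod w" r z]
    by (cases "t \<in> {0..1}") (auto simp: norm_divide)
  have int_rot: "integrable lborel (f t)" for t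
  proof -
    have "integrable lborel (\<lambda>\<zeta>. indicator D \<zeta> / cmod (z - \<zeta>))"
      unfolding D_def by (rule integrable_Cauchy_kernel_cball)
    then have "integrable (distr lborel borel ((*) (cis (2 * pi * t))))
        (\<lambda>\<zeta>. indicator D \<zeta> / cmod (z - \<zeta>))"
      by (simp add: distr_lborel_mult_unit)
    then have "integrable lborel (\<lambda>\<zeta>. indicator D (cis (2 * pi * t) * \<zeta>) / cmod (z - cis (2 * pi * t) * \<zeta>))"
      by (rule integrable_distr[rotated]) simp
    then show ?thesis
    proof (rule Bochner_Integration.integrable_bound)
      show "f t \<in> borel_measurable lborel"
        unfolding f_def by measurable
      have "indicator D (cis (2 * pi * t) * \<zeta>) = (indicator D \<zeta> :: real)" for \<zeta>
        by (simp add: D_def indicator_def norm_mult)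
      then show "AE \<zeta> in lborel. norm (f t \<zeta>)
          \<le> norm (indicator D (cis (2 * pi * t) * \<zeta>) / cmod (z - cis (2 * pi * t) * \<zeta>))"
        by (intro AE_I2) (simp add: f_def norm_divide indicator_def)
    qed
  qed
  \<comment> \<open>By rotation invariance the inner integral of the norm does not depend on
    \<open>t\<close> in the unit interval, which makes Fubini's condition immediate.\<close>
  have int_f: "integrable (lborel \<Otimes>\<^sub>M lborel) (case_prod f)"
  proof (rule lborel_pair.Fubini_integrable[OF meas_f])
    show "integrable lborel (\<lambda>t. LBINT \<zeta>. norm (case_prod f (t, \<zeta>)))"
      by (simp add: norm_f integrable_real_indicator)
  qed (simp add: int_rot)
  \<comment> \<open>The circle |\<zeta>| = |z| is excluded because the averaged kernel then meets
    its pole; it is a null set. Since \<open>z\<close> lies in \<open>D\<close>, the ball of radius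
    |z| is contained in \<open>D\<close> and the indicator of \<open>D\<close> disappears.\<close>
  have avg: "(LBINT t. f t \<zeta>) = indicator (ball 0 (cmod z)) \<zeta> *\<^sub>R (1 / z)"
    if ne: "\<zeta> \<notin> sphere 0 (cmod z)" for \<zeta>
  proof -
    let ?k = "\<lambda>t. 1 / (z - cis (2 * pi * t) * \<zeta>)"
    have has: "(?k has_integral indicator (ball 0 (cmod z)) \<zeta> *\<^sub>R (1 / z)) {0..1}"
      using circle_mean_Cauchy_kernel_inside[of \<zeta> z] circle_mean_Cauchy_kernel_outside[of z \<zeta>] ne
      by (cases "cmod \<zeta> < cmod z") auto
    have "z \<noteq> cis t * \<zeta>" for t
      using ne by (auto simp: norm_mult)
    then have "continuous_on {0..1} ?k"
      by (intro continuous_intros) auto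
    then have "set_integrable lborel {0..1} ?k"
      unfolding set_integrable_def by (intro borel_integrable_compact) auto
    from set_borel_integral_eq_integral(2)[OF this]
    have "(LINT t:{0..1}|lborel. ?k t) = indicator (ball 0 (cmod z)) \<zeta> *\<^sub>R (1 / z)"
      using has by (metis integral_unique)
    moreover have "(LBINT t. f t \<zeta>) = indicator D \<zeta> *\<^sub>R (LINT t:{0..1}|lborel. ?k t)"
      unfolding f_def set_lebesgue_integral_def by (cases "\<zeta> \<in> D") simp_all
    ultimately show ?thesis
      using z by (auto simp: D_def indicator_def)
  qed
  have "I = (LBINT t. LBINT \<zeta>. f t \<zeta>)"
    by (simp add: rot)
  also have "\<dots> = (LBINT \<zeta>. LBINT t. f t \<zeta>)"
    using lborel_pair.Fubini_integral[OF int_f] by simp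
  also have "\<dots> = (LBINT \<zeta>. indicator (ball (0::complex) (cmod z)) \<zeta> *\<^sub>R (1 / z))"
  proof (rule Bochner_Integration.integral_cong_AE)
    show "(\<lambda>\<zeta>. LBINT t. f t \<zeta>) \<in> borel_measurable lborel"
      using lborel_pair.integrable_snd[OF int_f] by (rule borel_measurable_integrable)
    have "sphere 0 (cmod z) \<in> null_sets lborel"
      using negligible_sphere[of 0 "cmod z"]
      by (simp add: negligible_iff_null_sets null_sets_completion_iff)
    then have "AE \<zeta> in lborel. \<zeta> \<notin> sphere 0 (cmod z)"
      by (rule AE_not_in)
    then show "AE \<zeta> in lborel. (LBINT t. f t \<zeta>) = indicator (ball 0 (cmod z)) \<zeta> *\<^sub>R (1 / z)"
      by eventually_elim (rule avg)
  qed (auto intro!: borel_measurable_scaleR borel_measurable_indicator)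
  also have "\<dots> = measure lborel (ball (0::complex) (cmod z)) *\<^sub>R (1 / z)"
    using emeasure_lborel_ball_finite[of "0::complex" "cmod z"]
    by (intro has_bochner_integral_integral_eq has_bochner_integral_indicator) simp_all
  also have "\<dots> = of_real (pi * (cmod z)\<^sup>2) / z"
    by (simp add: content_ball unit_ball_vol_2 scaleR_conv_of_real)
  also have "\<dots> = pi * cnj z"
  proof (cases "z = 0")
    case False
    have "of_real (pi * (cmod z)\<^sup>2) = of_real pi * (z * cnj z)"
      by (simp only: complex_norm_square of_real_mult)
    then show ?thesis using False by (simp only: nonzero_mult_div_cancel_left times_divide_eq_right
          mult.left_commute[of _ z] not_False_eq_True)
  qed simp
  finally show ?thesis by (simp add: I_def D_def)
qed

section \<open>Approximation of the Cauchy kernel\<close>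

text \<open>The integrals are decreasing in \<open>\<epsilon>\<close> and tend to zero for fixed \<open>z\<close>; uniformity
  follows by compactness, after the translation \<open>\<zeta> = z + w\<close> which fixes the singularity.\<close>

lemma uniformly_small_kernel_integral:
  fixes F :: "complex \<Rightarrow> complex"
  assumes "0 < \<eta>" and F: "continuous_on UNIV F"
    and null: "\<And>c. c \<in> cball 0 r \<Longrightarrow> {\<zeta> \<in> cball 0 r. F \<zeta> = F c} \<in> null_sets lborel"
  shows "\<exists>\<epsilon>>0. \<forall>z\<in>cball 0 r.
    (LBINT \<zeta>. indicator (cball 0 r) \<zeta> *
      (\<epsilon> / (cmod (z - \<zeta>) * (cmod ((z - \<zeta>) * (F z - F \<zeta>)) + \<epsilon>)))) < \<eta>"
proof (rule ccontr)
  define D :: "complex set" where "D = cball 0 r"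
  have [measurable]: "D \<in> sets borel" by (simp add: D_def)
  have [measurable]: "F \<in> borel_measurable borel"
    by (rule borel_measurable_continuous_onI[OF F])
  define I where "I \<epsilon> z = (LBINT \<zeta>. indicator D \<zeta> *
      (\<epsilon> / (cmod (z - \<zeta>) * (cmod ((z - \<zeta>) * (F z - F \<zeta>)) + \<epsilon>))))" for \<epsilon> z
  define e where "e n = inverse (real (Suc n))" for n
  have "e n > 0" for n by (simp add: e_def)
  assume "\<not> ?thesis"
  then have "\<forall>n. \<exists>z\<in>D. \<eta> \<le> I (e n) z"
    unfolding I_def D_def using \<open>\<And>n. e n > 0\<close> by (meson not_less)
  then obtain Z where Z: "\<And>n. Z n \<in> D" "\<And>n. \<eta> \<le> I (e n) (Z n)"
    by metis
  have "compact D" by (simp add: D_def)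
  then obtain l s where "l \<in> D" and s: "strict_mono s" and Zl: "(Z \<circ> s) \<longlonglongrightarrow> l"
    using Z(1) unfolding compact_def by metis
  define y where "y n = Z (s n)" for n
  define d where "d n = e (s n)" for n
  have y: "y n \<in> D" "y \<longlonglongrightarrow> l" for n
    using Z(1) Zl by (simp_all add: y_def[abs_def] o_def)
  have d: "d n > 0" "d \<longlonglongrightarrow> 0" for n
    using \<open>e (s n) > 0\<close> LIMSEQ_subseq_LIMSEQ[OF LIMSEQ_inverse_real_of_nat s]
    by (simp_all add: d_def[abs_def] e_def o_def)
  \<comment> \<open>After the translation the singularity sits at w = 0 for every \<open>n\<close>,
    at the price of a domain that moves with \<open>n\<close>.\<close>
  define u where "u n w = indicator D (y n + w) *
    (d n / (cmod w * (cmod (w * (F (y n) - F (y n + w))) + d n)))" for n w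
  have [measurable]: "u n \<in> borel_measurable borel" for n
    unfolding u_def by measurable
  have I_eq: "I (d n) (y n) = (LBINT w. u n w)" for n
  proof -
    have "(LBINT w. u n w) = (LBINT w. (\<lambda>\<zeta>. u n (- y n + \<zeta>)) (y n + w))"
      by simp
    also have "\<dots> = (\<integral>\<zeta>. u n (- y n + \<zeta>) \<partial>distr lborel borel ((+) (y n)))"
      by (rule integral_distr[symmetric]) simp_all
    also have "\<dots> = I (d n) (y n)"
      unfolding lborel_distr_plus I_def u_def
      by (intro Bochner_Integration.integral_cong)
        (auto simp: norm_mult norm_minus_commute)
    finally show ?thesis ..
  qed
  have "AE \<zeta> in lborel. \<zeta> \<notin> {\<zeta> \<in> D. F \<zeta> = F l}"
    using null \<open>l \<in> D\<close> unfolding D_def by (intro AE_not_in)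
  then have "AE \<zeta> in distr lborel borel ((+) l). \<zeta> \<notin> {\<zeta> \<in> D. F \<zeta> = F l}"
    by (simp only: lborel_distr_plus)
  then have AE_l: "AE w in lborel. l + w \<notin> {\<zeta> \<in> D. F \<zeta> = F l}"
    by (rule AE_distrD[rotated]) simp
  \<comment> \<open>If \<open>l + w\<close> is outside the closed disc, the moving indicator is
    eventually 0. Otherwise \<open>F l\<close> differs from \<open>F (l + w)\<close>, so for nonzero
    w the denominator has a nonzero limit while \<open>d\<close> tends to 0. At w = 0 division by
    zero gives the value 0.\<close>
  have lim: "(\<lambda>n. u n w) \<longlonglongrightarrow> 0" if w: "l + w \<notin> {\<zeta> \<in> D. F \<zeta> = F l}" for w
  proof (cases "l + w \<in> D")
    case False
    have "(\<lambda>n. y n + w) \<longlonglongrightarrow> l + w"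
      using y by (intro tendsto_intros)
    then have "\<forall>\<^sub>F n in sequentially. y n + w \<in> - D"
      using False by (intro topological_tendstoD) (auto simp: D_def)
    then have "\<forall>\<^sub>F n in sequentially. u n w = 0"
      by eventually_elim (simp add: u_def)
    then show ?thesis by (rule tendsto_eventually)
  next
    case True
    then have ne: "F l - F (l + w) \<noteq> 0" using w by auto
    show ?thesis
    proof (cases "w = 0")
      case False
      have "isCont F x" for x
        using F by (simp add: continuous_on_eq_continuous_at)
      then have "(\<lambda>n. d n / (cmod w * (cmod (w * (F (y n) - F (y n + w))) + d n)))
          \<longlonglongrightarrow> 0 / (cmod w * (cmod (w * (F l - F (l + w))) + 0))"
        using False ne y d by (intro tendsto_intros isCont_tendsto_compose[of _ F]) auto
      then show ?thesis
        by (intro Lim_null_comparison[of "\<lambda>n. u n w"])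
          (auto simp: u_def indicator_def d(1) less_imp_le intro!: eventuallyI)
    qed (simp add: u_def)
  qed
  \<comment> \<open>Two points of the disc differ by at most \<open>2 * r\<close>, so this
    dominating function is independent of \<open>n\<close>.\<close>
  have dom: "norm (u n w) \<le> indicator (cball 0 (2 * r)) w / cmod w" for n w
  proof (cases "y n + w \<in> D \<and> w \<noteq> 0")
    case True
    have "cmod w \<le> cmod (y n + w) + cmod (y n)"
      by (metis add_diff_cancel_left' norm_triangle_ineq4)
    then have "w \<in> cball 0 (2 * r)"
      using True y(1)[of n] by (simp add: D_def)
    moreover have "d n / (cmod w * (cmod (w * (F (y n) - F (y n + w))) + d n)) \<le> 1 / cmod w"
      using True d(1)[of n] by (simp add: divide_simps add_nonneg_pos)
    ultimately show ?thesis
      using True d(1)[of n] by (simp add: u_def)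
  qed (auto simp: u_def)
  have "(\<lambda>n. LBINT w. u n w) \<longlonglongrightarrow> (LBINT w::complex. 0)"
  proof (rule integral_dominated_convergence)
    show "integrable lborel (\<lambda>w::complex. indicator (cball 0 (2 * r)) w / cmod w)"
      by (rule integrable_inverse_norm_cball)
    show "AE w in lborel. (\<lambda>n. u n w) \<longlonglongrightarrow> 0"
      using AE_l by eventually_elim (rule lim)
  qed (use dom in simp_all)
  then have "(\<lambda>n. I (d n) (y n)) \<longlonglongrightarrow> 0"
    by (simp add: I_eq)
  moreover have "\<eta> \<le> I (d n) (y n)" for n
    using Z(2) by (simp add: d_def y_def)
  ultimately have "\<eta> \<le> 0"
    by (intro LIMSEQ_le_const) auto
  with \<open>0 < \<eta>\<close> show False by simp
qed

section \<open>Discretisation of the Cauchy integral\<close>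

text \<open>Each point is sent to the first centre, in some order of \<open>K\<close>, whose ball
  contains it, which is a piecewise constant Borel map. It lets the unit constants be used at
  finitely many centres only, so they never have to depend measurably on \<zeta>.\<close>

lemma finite_measurable_net:
  fixes K :: "'a::{metric_space, second_countable_topology} set"
  assumes "finite K" "K \<noteq> {}" "D \<subseteq> (\<Union>x\<in>K. ball x e)"
  obtains g where "g \<in> borel_measurable borel" "\<And>\<zeta>. g \<zeta> \<in> K" "\<And>\<zeta>. \<zeta> \<in> D \<Longrightarrow> dist (g \<zeta>) \<zeta> < e"
proof -
  have "\<exists>g\<in>borel_measurable borel. (\<forall>\<zeta>. g \<zeta> \<in> K) \<and>
      (\<forall>\<zeta>\<in>(\<Union>x\<in>K. ball x e). dist (g \<zeta>) \<zeta> < e)"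
    using assms(1,2)
  proof (induction rule: finite_ne_induct)
    case (singleton x)
    then show ?case by (intro bexI[of _ "\<lambda>_. x"]) auto
  next
    case (insert x K)
    then obtain g where g: "g \<in> borel_measurable borel" "\<And>\<zeta>. g \<zeta> \<in> K"
      "\<And>\<zeta>. \<zeta> \<in> (\<Union>x\<in>K. ball x e) \<Longrightarrow> dist (g \<zeta>) \<zeta> < e" by blast
    show ?case
    proof (intro bexI conjI allI ballI)
      show "(\<lambda>\<zeta>. if \<zeta> \<in> ball x e then x else g \<zeta>) \<in> borel_measurable borel"
        using g(1) by (intro measurable_If_set) auto
    qed (use g in auto)
  qed
  then show thesis using that assms(3) by blast
qed

text \<open>Since \<open>g\<close> takes finitely many values, the integrand is a simple function
  for arbitrary \<open>h\<close>. The resulting finite sum is what keeps the integral inside the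
  algebra.\<close>

lemma integral_finite_range:
  fixes h :: "'a \<Rightarrow> 'b :: {banach, second_countable_topology}"
  assumes "finite K" "A \<in> sets M" "emeasure M A < \<infinity>"
    and g: "\<And>a. a \<in> K \<Longrightarrow> {\<zeta> \<in> A. g \<zeta> = a} \<in> sets M" "\<And>\<zeta>. g \<zeta> \<in> K"
  shows "integrable M (\<lambda>\<zeta>. indicator A \<zeta> *\<^sub>R h (g \<zeta>))"
    and "(\<integral>\<zeta>. indicator A \<zeta> *\<^sub>R h (g \<zeta>) \<partial>M) = (\<Sum>a\<in>K. measure M {\<zeta> \<in> A. g \<zeta> = a} *\<^sub>R h a)"
proof -
  have eq: "indicator A \<zeta> *\<^sub>R h (g \<zeta>) = (\<Sum>a\<in>K. indicator {\<zeta> \<in> A. g \<zeta> = a} \<zeta> *\<^sub>R h a)" for \<zeta>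
  proof -
    have "(\<Sum>a\<in>K. indicator {\<zeta> \<in> A. g \<zeta> = a} \<zeta> *\<^sub>R h a)
        = (\<Sum>a\<in>K. if a = g \<zeta> then indicator A \<zeta> *\<^sub>R h a else 0)"
      by (intro sum.cong) (auto simp: indicator_def)
    then show ?thesis using assms(1) g(2) by simp
  qed
  have "has_bochner_integral M (\<lambda>\<zeta>. indicator {\<zeta> \<in> A. g \<zeta> = a} \<zeta> *\<^sub>R h a)
      (measure M {\<zeta> \<in> A. g \<zeta> = a} *\<^sub>R h a)" if "a \<in> K" for a
  proof (rule has_bochner_integral_indicator)
    show "emeasure M {\<zeta> \<in> A. g \<zeta> = a} < \<infinity>"
      using emeasure_mono[of "{\<zeta> \<in> A. g \<zeta> = a}" A M] assms(2,3)
      by (auto intro: le_less_trans)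
  qed (use g that in auto)
  then have "has_bochner_integral M (\<lambda>\<zeta>. \<Sum>a\<in>K. indicator {\<zeta> \<in> A. g \<zeta> = a} \<zeta> *\<^sub>R h a)
      (\<Sum>a\<in>K. measure M {\<zeta> \<in> A. g \<zeta> = a} *\<^sub>R h a)"
    by (rule has_bochner_integral_sum)
  then show "integrable M (\<lambda>\<zeta>. indicator A \<zeta> *\<^sub>R h (g \<zeta>))"
    "(\<integral>\<zeta>. indicator A \<zeta> *\<^sub>R h (g \<zeta>) \<partial>M) = (\<Sum>a\<in>K. measure M {\<zeta> \<in> A. g \<zeta> = a} *\<^sub>R h a)"
    unfolding eq by (auto simp: has_bochner_integral_iff)
qed

text \<open>The polynomially approximable function \<open>C (F z - F a) / (C (z - a) (F z - F a) + \<epsilon>)\<close>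
  stands in for the Cauchy kernel \<open>1 / (z - \<zeta>)\<close> for all \<open>\<zeta>\<close> near \<open>a\<close>.\<close>

lemma Cauchy_kernel_approximation_bound:
  fixes C z \<zeta> a w v u :: complex and \<epsilon> :: real
  defines "A \<equiv> C * ((z - a) * (w - v)) + of_real \<epsilon>"
  assumes "\<epsilon> > 0" "cmod C = 1" "0 \<le> Re (C * ((z - a) * (w - v)))" "z \<noteq> \<zeta>"
    and near: "cmod ((\<zeta> - a) * (w - v)) \<le> \<epsilon>"
      "cmod ((z - \<zeta>) * (w - u) - (z - a) * (w - v)) \<le> \<epsilon>"
  shows "cmod (1 / (z - \<zeta>) - C * (w - v) * inverse A)
    \<le> 6 * (\<epsilon> / (cmod (z - \<zeta>) * (cmod ((z - \<zeta>) * (w - u)) + \<epsilon>)))"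
proof -
  define P where "P = C * ((z - a) * (w - v))"
  have A: "A = P + of_real \<epsilon>" by (simp add: A_def P_def)
  have "Re P \<ge> 0" using assms by (simp add: P_def)
  have "\<epsilon> \<le> Re A" using \<open>Re P \<ge> 0\<close> by (simp add: A)
  then have "\<epsilon> \<le> cmod A" using complex_Re_le_cmod[of A] by linarith
  then have "A \<noteq> 0" using \<open>\<epsilon> > 0\<close> by auto
  \<comment> \<open>Adding the positive number \<epsilon> to \<open>P\<close> does not decrease the
    modulus because the real part of \<open>P\<close> is nonnegative.\<close>
  have "cmod P \<le> cmod A"
  proof (rule power2_le_imp_le)
    have "0 \<le> Re P * \<epsilon>" using \<open>Re P \<ge> 0\<close> \<open>\<epsilon> > 0\<close> by simp
    then show "(cmod P)\<^sup>2 \<le> (cmod A)\<^sup>2"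
      unfolding cmod_power2 A by (simp add: power2_eq_square algebra_simps)
  qed simp
  have "cmod P = cmod ((z - a) * (w - v))"
    using assms by (simp add: P_def norm_mult)
  then have "cmod ((z - \<zeta>) * (w - u)) \<le> cmod P + \<epsilon>"
    using order_trans[OF norm_triangle_sub add_left_mono[OF near(2)]] by metis
  with \<open>cmod P \<le> cmod A\<close> have "cmod ((z - \<zeta>) * (w - u)) \<le> cmod A + \<epsilon>"
    by (meson add_right_mono order_trans)
  \<comment> \<open>The left numerator is at most |A| + 2 \<epsilon>, and \<epsilon> is at most |A|;
    this is the factor 3. With the bound 2 \<epsilon> for the numerator below it produces the
    constant 6.\<close>
  then have A_ge: "(cmod ((z - \<zeta>) * (w - u)) + \<epsilon>) / 3 \<le> cmod A"
    using \<open>\<epsilon> \<le> cmod A\<close> by (simp add: field_simps)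
  have "1 / (z - \<zeta>) - C * (w - v) * inverse A = (C * ((\<zeta> - a) * (w - v)) + of_real \<epsilon>) / ((z - \<zeta>) * A)"
  proof -
    have "1 / (z - \<zeta>) - C * (w - v) * inverse A = (A - (z - \<zeta>) * (C * (w - v))) / ((z - \<zeta>) * A)"
      using \<open>A \<noteq> 0\<close> \<open>z \<noteq> \<zeta>\<close> by (simp add: divide_simps)
    also have "A - (z - \<zeta>) * (C * (w - v)) = C * ((\<zeta> - a) * (w - v)) + of_real \<epsilon>"
      by (simp add: A_def algebra_simps)
    finally show ?thesis .
  qed
  then have "cmod (1 / (z - \<zeta>) - C * (w - v) * inverse A)
      = cmod (C * ((\<zeta> - a) * (w - v)) + of_real \<epsilon>) / (cmod (z - \<zeta>) * cmod A)"
    by (simp add: norm_divide norm_mult)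
  also have "\<dots> \<le> (2 * \<epsilon>) / (cmod (z - \<zeta>) * ((cmod ((z - \<zeta>) * (w - u)) + \<epsilon>) / 3))"
  proof (intro frac_le mult_left_mono A_ge mult_pos_pos)
    have "cmod (C * ((\<zeta> - a) * (w - v)) + of_real \<epsilon>) \<le> cmod (C * ((\<zeta> - a) * (w - v))) + cmod (of_real \<epsilon>)"
      by (rule norm_triangle_ineq)
    then show "cmod (C * ((\<zeta> - a) * (w - v)) + of_real \<epsilon>) \<le> 2 * \<epsilon>"
      using near(1) \<open>\<epsilon> > 0\<close> \<open>cmod C = 1\<close> by (simp add: norm_mult)
    show "0 < (cmod ((z - \<zeta>) * (w - u)) + \<epsilon>) / 3"
      using \<open>\<epsilon> > 0\<close> by (simp add: add_nonneg_pos)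
  qed (use \<open>\<epsilon> > 0\<close> \<open>z \<noteq> \<zeta>\<close> in auto)
  also have "\<dots> = 6 * (\<epsilon> / (cmod (z - \<zeta>) * (cmod ((z - \<zeta>) * (w - u)) + \<epsilon>)))"
    by simp
  finally show ?thesis .
qed

text \<open>The Cauchy integral for \<open>cnj z\<close> is compared with the integral of the
  substitute kernel taken at the nearest selected centre. The latter is a finite combination of
  approximable functions, and the error is at most 6 / pi times an integral that is small uniformly
  in z.\<close>

lemma polynomially_approximable_cnj:
  assumes "r > 0" and F: "continuous_on (cball 0 r) F"
    and ex_C: "\<And>\<zeta>. \<zeta> \<in> cball 0 r \<Longrightarrow>
      \<exists>C. cmod C = 1 \<and> (\<forall>z\<in>cball 0 r. 0 \<le> Re (C * ((z - \<zeta>) * (F z - F \<zeta>))))"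
    and null: "\<And>c. c \<in> cball 0 r \<Longrightarrow> {\<zeta> \<in> cball 0 r. F \<zeta> = F c} \<in> null_sets lborel"
  shows "polynomially_approximable (graph_over (cball 0 r) F) (\<lambda>x. cnj (x $ 1))"
proof (rule polynomially_approximable_uniform_limit)
  fix e :: real assume "e > 0"
  define D :: "complex set" where "D = cball 0 r"
  have D: "compact D" "D \<noteq> {}" "D \<in> sets borel"
    using \<open>r > 0\<close> by (auto simp: D_def)
  define X where "X = graph_over D F"
  have "bounded X"
    using compact_graph_over[OF D(1)] F by (simp add: X_def D_def compact_imp_bounded)
  \<comment> \<open>The nearest point retraction extends \<open>F\<close> from the disc to a
    continuous function on the plane, as the translation argument for the kernel integrals
    requires.\<close>
  define G where "G = F \<circ> closest_point D"
  have G: "continuous_on UNIV G"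
    unfolding G_def using D F
    by (intro continuous_on_compose continuous_on_closest_point)
      (auto simp: D_def intro!: continuous_on_subset[OF F] closest_point_in_set)
  have GF: "G z = F z" if "z \<in> D" for z
    using that by (simp add: G_def closest_point_self)
  have [measurable]: "G \<in> borel_measurable borel"
    by (rule borel_measurable_continuous_onI[OF G])
  define J where "J \<epsilon> z \<zeta> = indicator D \<zeta> *
    (\<epsilon> / (cmod (z - \<zeta>) * (cmod ((z - \<zeta>) * (G z - G \<zeta>)) + \<epsilon>)))" for \<epsilon> z \<zeta>
  have "{\<zeta> \<in> D. G \<zeta> = G c} = {\<zeta> \<in> D. F \<zeta> = F c}" if "c \<in> D" for c
    using GF that by auto
  then obtain \<epsilon> where "\<epsilon> > 0" and small: "\<And>z. z \<in> D \<Longrightarrow> (LBINT \<zeta>. J \<epsilon> z \<zeta>) < pi * e / 6"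
    using uniformly_small_kernel_integral[OF _ G, of "pi * e / 6" r] null \<open>e > 0\<close>
    unfolding J_def D_def by auto
  have int_J: "integrable lborel (J \<epsilon> z)" for z
  proof (rule Bochner_Integration.integrable_bound[OF integrable_Cauchy_kernel_cball[of r z]])
    show "J \<epsilon> z \<in> borel_measurable lborel"
      unfolding J_def using D(3) by measurable
    have "norm (J \<epsilon> z \<zeta>) \<le> norm (indicator D \<zeta> / cmod (z - \<zeta>))" for \<zeta>
      using \<open>\<epsilon> > 0\<close> by (cases "z = \<zeta>") (auto simp: J_def indicator_def divide_simps add_nonneg_pos)
    then show "AE \<zeta> in lborel. norm (J \<epsilon> z \<zeta>) \<le> norm (indicator (cball 0 r) \<zeta> / cmod (z - \<zeta>))"
      by (simp add: D_def)
  qed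
  have "bounded (F ` D)"
    using D F by (intro compact_imp_bounded compact_continuous_image) (simp_all add: D_def)
  then obtain M where "M > 0" and M: "\<And>z. z \<in> D \<Longrightarrow> cmod (F z) \<le> M"
    unfolding bounded_pos by auto
  have "uniformly_continuous_on D F"
    using D F by (intro compact_uniformly_continuous) (simp_all add: D_def)
  then obtain \<delta>0 where "\<delta>0 > 0" and \<delta>0: "\<And>z z'. z \<in> D \<Longrightarrow> z' \<in> D \<Longrightarrow> dist z' z < \<delta>0 \<Longrightarrow>
      dist (F z') (F z) < \<epsilon> / (4 * r)"
    unfolding uniformly_continuous_on_def using \<open>\<epsilon> > 0\<close> \<open>r > 0\<close>
    by (metis zero_less_divide_iff zero_less_mult_iff zero_less_numeral)
  \<comment> \<open>On the disc |F z - F a| <= 2 M and |z - \<zeta>| <= 2 r, so the denominators 4 M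
    here and 4 r above make each of the two error products at most \<epsilon> / 2.\<close>
  define \<delta> where "\<delta> = min \<delta>0 (\<epsilon> / (4 * M))"
  have "\<delta> > 0" using \<open>\<delta>0 > 0\<close> \<open>\<epsilon> > 0\<close> \<open>M > 0\<close> by (simp add: \<delta>_def)
  obtain K where K: "K \<subseteq> D" "finite K" "D \<subseteq> (\<Union>x\<in>K. ball x \<delta>)"
    using compactE_image[OF D(1), of D "\<lambda>x. ball x \<delta>"] \<open>\<delta> > 0\<close> by (metis (no_types, lifting) UN_I centre_in_ball open_ball subsetI)
  have "K \<noteq> {}" using K(3) D(2) by auto
  obtain g where [measurable]: "g \<in> borel_measurable borel"
    and g: "\<And>\<zeta>. g \<zeta> \<in> K" "\<And>\<zeta>. \<zeta> \<in> D \<Longrightarrow> dist (g \<zeta>) \<zeta> < \<delta>"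
    using finite_measurable_net[OF K(2) \<open>K \<noteq> {}\<close> K(3)] by blast
  obtain C where C: "\<And>\<zeta>. \<zeta> \<in> D \<Longrightarrow> cmod (C \<zeta>) = 1"
    "\<And>\<zeta> z. \<zeta> \<in> D \<Longrightarrow> z \<in> D \<Longrightarrow> 0 \<le> Re (C \<zeta> * ((z - \<zeta>) * (F z - F \<zeta>)))"
    using ex_C unfolding D_def by metis
  define k where "k z w a = C a * (w - F a) * inverse (C a * ((z - a) * (w - F a)) + of_real \<epsilon>)" for z w a
  define m where "m a = measure lborel {\<zeta> \<in> D. g \<zeta> = a}" for a
  \<comment> \<open>This is 1 / pi times the integral of the discretised kernel, with
    \<open>m a\<close> the area of the set of points assigned to the centre
    \<open>a\<close>.\<close>
  define H where "H x = of_real (1 / pi) * (\<Sum>a\<in>K. of_real (m a) * k (x $ 1) (x $ 2) a)" for x :: "complex ^ 2"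
  have "polynomially_approximable X (\<lambda>x. k (x $ 1) (x $ 2) a)" if "a \<in> K" for a
    unfolding k_def
  proof (intro polynomially_approximable_mult polynomially_approximable_inverse[OF _ _ \<open>\<epsilon> > 0\<close>]
      polynomially_approximable_add polynomially_approximable_diff polynomially_approximable_const
      polynomially_approximable_nth \<open>bounded X\<close>)
    fix x assume "x \<in> X"
    then obtain z where "z \<in> D" "x $ 1 = z" "x $ 2 = F z"
      by (auto simp: X_def graph_over_def)
    with C(2)[of a z] that K(1) show "\<epsilon> \<le> Re (C a * ((x $ 1 - a) * (x $ 2 - F a)) + of_real \<epsilon>)"
      by auto
  qed
  then have "polynomially_approximable X H"
    unfolding H_def using \<open>bounded X\<close>
    by (intro polynomially_approximable_mult polynomially_approximable_sum
        polynomially_approximable_const)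
  moreover have "cmod (cnj z - H (vector [z, F z])) < e" if "z \<in> D" for z
  proof -
    let ?d = "\<lambda>\<zeta>. indicator D \<zeta> *\<^sub>R (1 / (z - \<zeta>)) - indicator D \<zeta> *\<^sub>R k z (F z) (g \<zeta>)"
    have "D \<in> sets lborel" "emeasure lborel D < \<infinity>"
      using D(3) emeasure_lborel_cball_finite by (auto simp: D_def)
    moreover have "{\<zeta> \<in> D. g \<zeta> = a} \<in> sets lborel" for a
    proof -
      have "{\<zeta> \<in> D. g \<zeta> = a} = D \<inter> g -` {a}" by auto
      also have "\<dots> \<in> sets lborel"
        using D(3) measurable_sets[of g borel borel "{a}"] by auto
      finally show ?thesis .
    qed
    ultimately have int_k: "integrable lborel (\<lambda>\<zeta>. indicator D \<zeta> *\<^sub>R k z (F z) (g \<zeta>))"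
      and integral_k: "(LBINT \<zeta>. indicator D \<zeta> *\<^sub>R k z (F z) (g \<zeta>)) = (\<Sum>a\<in>K. m a *\<^sub>R k z (F z) a)"
      using integral_finite_range[OF K(2), of D lborel g "k z (F z)"] g(1) unfolding m_def by blast+
    have int_C: "integrable lborel (\<lambda>\<zeta>. indicator D \<zeta> *\<^sub>R (1 / (z - \<zeta>)))"
    proof (rule Bochner_Integration.integrable_bound[OF integrable_Cauchy_kernel_cball[of r z]])
      show "(\<lambda>\<zeta>. indicator D \<zeta> *\<^sub>R (1 / (z - \<zeta>))) \<in> borel_measurable lborel"
        using D(3) by measurable
    qed (simp add: D_def norm_divide)
    have "pi * cmod (cnj z - H (vector [z, F z])) = cmod (LBINT \<zeta>. ?d \<zeta>)"
    proof -
      have "(LBINT \<zeta>. ?d \<zeta>) = of_real pi * cnj z - (\<Sum>a\<in>K. m a *\<^sub>R k z (F z) a)"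
        using integral_Cauchy_kernel_cball[of z r] that int_C int_k integral_k by (simp add: D_def)
      also have "\<dots> = of_real pi * (cnj z - H (vector [z, F z]))"
        by (simp add: H_def scaleR_conv_of_real right_diff_distrib)
      finally show ?thesis by (simp add: norm_mult)
    qed
    also have "\<dots> \<le> (LBINT \<zeta>. norm (?d \<zeta>))"
      by (rule integral_norm_bound)
    also have "\<dots> \<le> (LBINT \<zeta>. 6 * J \<epsilon> z \<zeta>)"
    proof (rule integral_mono_AE)
      \<comment> \<open>The pointwise bound needs \<zeta> different from \<open>z\<close>, which
        excludes a single point.\<close>
      show "AE \<zeta> in lborel. norm (?d \<zeta>) \<le> 6 * J \<epsilon> z \<zeta>"
        using AE_lborel_singleton[of z]
      proof eventually_elim
        case (elim \<zeta>)
        show ?case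
        proof (cases "\<zeta> \<in> D")
          case True
          let ?a = "g \<zeta>"
          have a: "?a \<in> D" using g(1) K(1) by auto
          have le_M: "cmod (F z - F ?a) \<le> 2 * M"
            using M[OF a] M[OF that] norm_triangle_ineq4[of "F z" "F ?a"] by linarith
          have "cmod (\<zeta> - ?a) \<le> \<epsilon> / (4 * M)"
            using g(2)[OF True] by (simp add: \<delta>_def dist_norm norm_minus_commute)
          then have "cmod (\<zeta> - ?a) * cmod (F z - F ?a) \<le> \<epsilon> / (4 * M) * (2 * M)"
            using le_M \<open>\<epsilon> > 0\<close> \<open>M > 0\<close> by (intro mult_mono) auto
          then have near1: "cmod ((\<zeta> - ?a) * (F z - F ?a)) \<le> \<epsilon> / 2"
            using \<open>M > 0\<close> by (simp add: norm_mult)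
          have "cmod (F ?a - F \<zeta>) \<le> \<epsilon> / (4 * r)"
            using \<delta>0[OF True a] g(2)[OF True] by (simp add: \<delta>_def dist_norm)
          moreover have "cmod (z - \<zeta>) \<le> 2 * r"
            using True that norm_triangle_ineq4[of z \<zeta>] by (simp add: D_def)
          ultimately have "cmod (z - \<zeta>) * cmod (F ?a - F \<zeta>) \<le> 2 * r * (\<epsilon> / (4 * r))"
            using \<open>r > 0\<close> by (intro mult_mono) auto
          then have near2: "cmod ((z - \<zeta>) * (F ?a - F \<zeta>)) \<le> \<epsilon> / 2"
            using \<open>r > 0\<close> by (simp add: norm_mult)
          have "(z - \<zeta>) * (F z - F \<zeta>) - (z - ?a) * (F z - F ?a)
              = (z - \<zeta>) * (F ?a - F \<zeta>) - (\<zeta> - ?a) * (F z - F ?a)"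
            by (simp add: algebra_simps)
          then have near: "cmod ((z - \<zeta>) * (F z - F \<zeta>) - (z - ?a) * (F z - F ?a)) \<le> \<epsilon>"
            using order_trans[OF norm_triangle_ineq4 add_mono[OF near2 near1]] by simp
          have "cmod (1 / (z - \<zeta>) - k z (F z) ?a)
              \<le> 6 * (\<epsilon> / (cmod (z - \<zeta>) * (cmod ((z - \<zeta>) * (F z - F \<zeta>)) + \<epsilon>)))"
            unfolding k_def using elim near1 near C a that \<open>\<epsilon> > 0\<close>
            by (intro Cauchy_kernel_approximation_bound) auto
          then show ?thesis
            using True that by (simp add: J_def GF)
        qed (simp add: J_def)
      qed
    qed (use int_C int_k int_J in auto)
    also have "\<dots> < pi * e"
      using small[OF that] by simp
    finally show ?thesis by simp
  qed
  ultimately show "\<exists>g. polynomially_approximable (graph_over (cball 0 r) F) g \<and>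
      (\<forall>x\<in>graph_over (cball 0 r) F. cmod (cnj (x $ 1) - g x) < e)"
    by (intro exI[of _ H]) (auto simp: X_def D_def graph_over_def)
qed

section \<open>Level sets and density\<close>

text \<open>A real linear function of z is a complex combination of z and \<open>cnj z\<close>.
  Hence the algebra contains all real polynomials in the real and imaginary parts, and these are
  uniformly dense by Stone-Weierstrass.\<close>

lemma polynomially_approximable_continuous:
  assumes "compact S" and F: "continuous_on S F"
    and cnj: "polynomially_approximable (graph_over S F) (\<lambda>x. cnj (x $ 1))"
    and f: "continuous_on S f"
  shows "polynomially_approximable (graph_over S F) (\<lambda>x. f (x $ 1))"
proof -
  define X where "X = graph_over S F"
  have X: "bounded X"
    using compact_graph_over[OF assms(1) F] by (simp add: X_def compact_imp_bounded)
  have cnj: "polynomially_approximable X (\<lambda>x. cnj (x $ 1))"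
    using cnj by (simp add: X_def)
  note intros = polynomially_approximable_add polynomially_approximable_mult[OF X]
    polynomially_approximable_diff[OF X] polynomially_approximable_const
    polynomially_approximable_nth cnj
  have real: "polynomially_approximable X (\<lambda>x. of_real (p (x $ 1)))"
    if "real_polynomial_function p" for p :: "complex \<Rightarrow> real"
    using that
  proof induction
    case (linear f)
    then interpret bounded_linear f .
    define a b where "a = f 1" and "b = f \<i>"
    have "of_real (f z) = of_real a * (1 / 2 * (z + cnj z))
        + of_real b * (1 / (2 * \<i>) * (z - cnj z))" for z
    proof -
      have "f z = f (Re z *\<^sub>R 1 + Im z *\<^sub>R \<i>)"
        by (rule arg_cong[of _ _ f]) (simp add: complex_eq_iff)
      also have "\<dots> = Re z * f 1 + Im z * f \<i>"
        by (simp only: add scaleR) simp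
      finally have f: "f z = Re z * a + Im z * b" by (simp add: a_def b_def)
      have "1 / 2 * (z + cnj z) = of_real (Re z)" "1 / (2 * \<i>) * (z - cnj z) = of_real (Im z)"
        by (simp_all add: complex_add_cnj complex_diff_cnj complex_eq_iff)
      then show ?thesis
        unfolding f by (simp only: of_real_add of_real_mult mult.commute)
    qed
    then show ?case
      by (simp only:) (intro intros)
  next
    case (const c)
    show ?case by (intro intros)
  next
    case (add f g)
    then show ?case by (simp only: of_real_add) (intro intros)
  next
    case (mult f g)
    then show ?case by (simp only: of_real_mult) (intro intros)
  qed
  show ?thesis
    unfolding X_def[symmetric]
  proof (rule polynomially_approximable_uniform_limit)
    fix e :: real assume "e > 0"
    then obtain g where g: "polynomial_function g" "\<forall>z\<in>S. cmod (f z - g z) < e"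
      using Stone_Weierstrass_polynomial_function[OF assms(1) f] by blast
    have "real_polynomial_function (\<lambda>z. Re (g z))" "real_polynomial_function (\<lambda>z. Im (g z))"
      using g(1) bounded_linear_Re bounded_linear_Im
      unfolding polynomial_function_def by (auto simp: o_def)
    then have "polynomially_approximable X (\<lambda>x. of_real (Re (g (x $ 1))) + \<i> * of_real (Im (g (x $ 1))))"
      by (intro intros real)
    then have "polynomially_approximable X (\<lambda>x. g (x $ 1))"
      by (simp add: complex_eq[symmetric])
    then show "\<exists>g. polynomially_approximable X g \<and> (\<forall>x\<in>X. cmod (f (x $ 1) - g x) < e)"
      using g(2) by (intro exI[of _ "\<lambda>x. g (x $ 1)"]) (auto simp: X_def graph_over_def)
  qed
qed

lemma uniform_algebra_z_eqI:
  assumes "compact S" and F: "continuous_on S F"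
    and approx: "\<And>f. continuous_on S f \<Longrightarrow>
      polynomially_approximable (graph_over S F) (\<lambda>x. f (x $ 1))"
  shows "uniform_algebra_z S F = mspace (C_space S)"
proof
  show "uniform_algebra_z S F \<subseteq> mspace (C_space S)"
    unfolding uniform_algebra_z_def using closure_of_subset_topspace by fastforce
next
  have in_C: "restrict f S \<in> mspace (C_space S)" if "continuous_on S f" for f
  proof -
    have "continuous_map (top_of_set S) euclidean (restrict f S)"
      using that by (simp cong: continuous_on_cong)
    then show ?thesis
      using assms(1) unfolding C_space_def
      by (subst compactin_mspace_cfunspace) (auto simp: compactin_subtopology)
  qed
  show "mspace (C_space S) \<subseteq> uniform_algebra_z S F"
  proof
    fix f assume f: "f \<in> mspace (C_space S)"
    then have "continuous_on S f"
      by (simp add: C_space_def)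
    have "\<exists>y\<in>{restrict (\<lambda>z. p (vector [z, F z])) S | p :: complex ^ 2 \<Rightarrow> complex.
          p \<in> holomorphic_polynomials}.
        y \<in> Metric_space.mball (mspace (C_space S)) (mdist (C_space S)) f e" if "e > 0" for e
    proof -
      \<comment> \<open>Half of \<open>e\<close> is used because the supremum of strict pointwise
        bounds is only bounded non-strictly, whereas the ball is open.\<close>
      obtain p where p: "p \<in> holomorphic_polynomials"
        "\<forall>x\<in>graph_over S F. cmod (f (x $ 1) - p x) < e / 2"
        using approx[OF \<open>continuous_on S f\<close>] \<open>e > 0\<close>
        unfolding polynomially_approximable_def by (meson half_gt_zero)
      define y where "y = restrict (\<lambda>z. p (vector [z, F z])) S"
      have "continuous_on S (\<lambda>z. p (\<chi> i. if i = 1 then z else F z))"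
      proof (intro continuous_on_compose2[OF continuous_on_holomorphic_polynomial[OF p(1), of UNIV]]
          continuous_on_vec_lambda)
        show "continuous_on S (\<lambda>z. if i = 1 then z else F z)" for i :: 2
          using F by (cases "i = 1") auto
      qed auto
      also have "(\<lambda>z. \<chi> i. if i = 1 then z else F z) = (\<lambda>z. vector [z, F z] :: complex ^ 2)"
        by (auto simp: fun_eq_iff vec_eq_iff forall_2)
      then have "(\<lambda>z. p (\<chi> i. if i = 1 then z else F z)) = (\<lambda>z. p (vector [z, F z]))"
        by (auto simp: fun_eq_iff dest: fun_cong)
      finally have y: "y \<in> mspace (C_space S)"
        unfolding y_def by (rule in_C)
      have "mdist (C_space S) f y \<le> e / 2"
        unfolding C_space_def
      proof (rule mdist_cfunspace_le)
        fix z assume "z \<in> topspace (top_of_set S)"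
        then have "cmod (f z - y z) < e / 2"
          using p(2) by (auto simp: y_def graph_over_def)
        then show "mdist euclidean_metric (f z) (y z) \<le> e / 2"
          by (simp add: dist_norm)
      qed (use \<open>e > 0\<close> in simp)
      then have "y \<in> Metric_space.mball (mspace (C_space S)) (mdist (C_space S)) f e"
        using f y \<open>e > 0\<close> by (simp add: Metric_space.in_mball)
      then show ?thesis
        using p(1) by (intro bexI[of _ y]) (use y_def in blast)+
    qed
    then show "f \<in> uniform_algebra_z S F"
      using f unfolding uniform_algebra_z_def mtopology_of_def
      by (simp add: Metric_space.metric_closure_of)
  qed
qed

section \<open>The cusp condition on the whole disc and its level sets\<close>

text \<open>Unit constants belonging to points that converge to \<zeta> have a convergent
  subsequence by compactness of the circle, and the cusp is a closed set, so the limit constant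
  serves \<zeta>.\<close>

lemma cusp_condition_dense:
  fixes F :: "complex \<Rightarrow> complex" and K \<nu> :: real
  assumes F: "continuous_on D F" and "0 < \<nu>"
    and dense: "D \<subseteq> closure S" and "S \<subseteq> D"
    and cusp: "\<And>\<zeta>. \<zeta> \<in> S \<Longrightarrow> \<exists>C. cmod C = 1 \<and> (\<forall>z\<in>D.
      0 \<le> Re (C * ((z - \<zeta>) * (F z - F \<zeta>))) \<and>
      \<bar>Im (C * ((z - \<zeta>) * (F z - F \<zeta>)))\<bar> \<le> K * Re (C * ((z - \<zeta>) * (F z - F \<zeta>))) powr (1 / \<nu>))"
    and "\<zeta> \<in> D"
  shows "\<exists>C. cmod C = 1 \<and> (\<forall>z\<in>D.
      0 \<le> Re (C * ((z - \<zeta>) * (F z - F \<zeta>))) \<and>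
      \<bar>Im (C * ((z - \<zeta>) * (F z - F \<zeta>)))\<bar> \<le> K * Re (C * ((z - \<zeta>) * (F z - F \<zeta>))) powr (1 / \<nu>))"
proof -
  obtain y where y: "\<And>n. y n \<in> S" "y \<longlonglongrightarrow> \<zeta>"
    using subsetD[OF dense \<open>\<zeta> \<in> D\<close>] unfolding closure_sequential by auto
  obtain c where c: "\<And>n. cmod (c n) = 1"
    "\<And>n z. z \<in> D \<Longrightarrow> 0 \<le> Re (c n * ((z - y n) * (F z - F (y n)))) \<and>
      \<bar>Im (c n * ((z - y n) * (F z - F (y n))))\<bar> \<le> K * Re (c n * ((z - y n) * (F z - F (y n)))) powr (1 / \<nu>)"
    using cusp[OF y(1)] by metis
  have "compact (sphere (0::complex) 1)" "\<forall>n. c n \<in> sphere 0 1"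
    using c(1) by auto
  then obtain C s where C: "C \<in> sphere 0 1" and s: "strict_mono s" and lim_c: "(c \<circ> s) \<longlonglongrightarrow> C"
    unfolding compact_def by metis
  show ?thesis
  proof (intro exI[of _ C] conjI ballI)
    fix z assume z: "z \<in> D"
    define w where "w n = c (s n) * ((z - y (s n)) * (F z - F (y (s n))))" for n
    have y_s: "(\<lambda>n. y (s n)) \<longlonglongrightarrow> \<zeta>"
      using LIMSEQ_subseq_LIMSEQ[OF y(2) s] by (simp add: o_def)
    have "(\<lambda>n. F (y (s n))) \<longlonglongrightarrow> F \<zeta>"
      using y(1) assms(4) \<open>\<zeta> \<in> D\<close>
      by (intro continuous_on_tendsto_compose[OF F y_s] always_eventually) blast+
    then have w: "w \<longlonglongrightarrow> C * ((z - \<zeta>) * (F z - F \<zeta>))"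
      unfolding w_def using lim_c y_s by (intro tendsto_intros) (simp_all add: o_def)
    have wn: "0 \<le> Re (w n)" "\<bar>Im (w n)\<bar> \<le> K * Re (w n) powr (1 / \<nu>)" for n
      using c(2)[OF z] by (simp_all add: w_def)
    show "0 \<le> Re (C * ((z - \<zeta>) * (F z - F \<zeta>)))"
      using wn(1) by (intro LIMSEQ_le_const[OF tendsto_Re[OF w]]) auto
    \<comment> \<open>The limit may be 0, where \<open>powr\<close> is continuous along nonnegative
      bases because the exponent 1 / \<nu> is positive.\<close>
    have "(\<lambda>n. K * Re (w n) powr (1 / \<nu>)) \<longlonglongrightarrow> K * Re (C * ((z - \<zeta>) * (F z - F \<zeta>))) powr (1 / \<nu>)"
      using wn(1) \<open>0 < \<nu>\<close> by (intro tendsto_mult tendsto_const tendsto_powr' tendsto_Re[OF w]) auto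
    then show "\<bar>Im (C * ((z - \<zeta>) * (F z - F \<zeta>)))\<bar> \<le> K * Re (C * ((z - \<zeta>) * (F z - F \<zeta>))) powr (1 / \<nu>)"
      using wn(2) by (intro LIMSEQ_le[OF tendsto_rabs[OF tendsto_Im[OF w]]]) auto
  qed (use C in simp)
qed

text \<open>A point \<open>\<zeta>\<close> off the level set is on the boundary of an open half plane containing the
  level set, so it is not in the convex hull of the level set.\<close>

lemma convex_level_set:
  assumes "convex D"
    and half_plane: "\<And>\<zeta>. \<zeta> \<in> D \<Longrightarrow> \<exists>C. C \<noteq> 0 \<and> (\<forall>z\<in>D.
      0 \<le> Re (C * ((z - \<zeta>) * (F z - F \<zeta>))) \<and>
      (Re (C * ((z - \<zeta>) * (F z - F \<zeta>))) = 0 \<longrightarrow> C * ((z - \<zeta>) * (F z - F \<zeta>)) = 0))"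
  shows "convex {\<zeta> \<in> D. F \<zeta> = (c::complex)}"
proof (rule convexI)
  fix a b and s t :: real
  assume ab: "a \<in> {\<zeta> \<in> D. F \<zeta> = c}" "b \<in> {\<zeta> \<in> D. F \<zeta> = c}"
    and st: "0 \<le> s" "0 \<le> t" "s + t = 1"
  define \<zeta> where "\<zeta> = s *\<^sub>R a + t *\<^sub>R b"
  have "\<zeta> \<in> D"
    using ab st \<open>convex D\<close> by (auto simp: \<zeta>_def intro: convexD)
  moreover have "F \<zeta> = c"
  proof (rule ccontr)
    assume "F \<zeta> \<noteq> c"
    obtain C where "C \<noteq> 0" and C: "\<And>z. z \<in> D \<Longrightarrow> 0 \<le> Re (C * ((z - \<zeta>) * (F z - F \<zeta>)))"
      "\<And>z. z \<in> D \<Longrightarrow> Re (C * ((z - \<zeta>) * (F z - F \<zeta>))) = 0 \<Longrightarrow> C * ((z - \<zeta>) * (F z - F \<zeta>)) = 0"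
      using half_plane[OF \<open>\<zeta> \<in> D\<close>] by blast
    \<comment> \<open>Replacing \<open>F z\<close> by the constant \<open>c\<close> makes this an
      affine function of z, so it respects convex combinations; it vanishes at \<zeta> but is
      positive on the level set.\<close>
    define L where "L z = Re (C * ((z - \<zeta>) * (c - F \<zeta>)))" for z
    have pos: "0 < L z" if "z \<in> D" "F z = c" for z
    proof -
      have "z \<noteq> \<zeta>" using that \<open>F \<zeta> \<noteq> c\<close> by auto
      then have "C * ((z - \<zeta>) * (F z - F \<zeta>)) \<noteq> 0"
        using \<open>C \<noteq> 0\<close> \<open>F \<zeta> \<noteq> c\<close> that by auto
      then show ?thesis
        using C(1,2)[OF that(1)] that(2) unfolding L_def by force
    qed
    have "C * ((\<zeta> - \<zeta>) * (c - F \<zeta>)) =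
        s *\<^sub>R (C * ((a - \<zeta>) * (c - F \<zeta>))) + t *\<^sub>R (C * ((b - \<zeta>) * (c - F \<zeta>)))"
    proof -
      have "of_real s * (a - \<zeta>) + of_real t * (b - \<zeta>) = \<zeta> - of_real (s + t) * \<zeta>"
        by (simp add: \<zeta>_def scaleR_conv_of_real algebra_simps)
      then have "of_real s * (a - \<zeta>) + of_real t * (b - \<zeta>) = 0"
        using st by simp
      then have "C * (c - F \<zeta>) * (of_real s * (a - \<zeta>) + of_real t * (b - \<zeta>)) = 0"
        by simp
      then show ?thesis by (simp add: algebra_simps scaleR_conv_of_real)
    qed
    from arg_cong[of _ _ Re, OF this] have "0 = s * L a + t * L b"
      by (simp only: L_def plus_complex.sel scaleR_complex.sel diff_self mult_zero_left
          mult_zero_right zero_complex.sel)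
    moreover have "0 < L a" "0 < L b" using pos ab by auto
    moreover have "0 < s \<or> 0 < t" using st by linarith
    ultimately show False
      using st by (smt (verit) mult_nonneg_nonneg mult_pos_pos)
  qed
  ultimately show "s *\<^sub>R a + t *\<^sub>R b \<in> {\<zeta> \<in> D. F \<zeta> = c}"
    by (simp add: \<zeta>_def)
qed

lemma dbar_eq_0_of_locally_constant:
  assumes "open U" "U \<subseteq> D" "z \<in> U" and const: "\<And>w. w \<in> U \<Longrightarrow> F w = c"
  shows "dbar D F z = 0"
proof -
  have "z \<in> interior D"
    using assms(1-3) by (meson interior_maximal subsetD)
  have "((\<lambda>_. c) has_derivative (\<lambda>_. 0)) (at z)" by simp
  then have "(F has_derivative (\<lambda>_. 0)) (at z)"
    by (rule has_derivative_transform_within_open[OF _ assms(1,3)]) (simp add: const)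
  then have "frechet_derivative F (at z) = (\<lambda>_. 0)"
    by (simp add: frechet_derivative_at[symmetric])
  then show ?thesis
    by (simp add: dbar_def at_within_interior[OF \<open>z \<in> interior D\<close>])
qed

text \<open>On the interior of a level set \<open>F\<close> is constant, so that interior is a
  relatively open part of the nowhere dense zero set and must be empty. A convex set without
  interior has measure zero.\<close>

lemma null_sets_level_set:
  assumes "closed D" "continuous_on D F" and convex: "convex {\<zeta> \<in> D. F \<zeta> = c}"
    and nd: "nowhere_dense_in (top_of_set D) {z \<in> D. dbar D F z = 0}"
  shows "{\<zeta> \<in> D. F \<zeta> = c} \<in> null_sets lborel"
proof -
  define L where "L = {\<zeta> \<in> D. F \<zeta> = c}"
  have "L \<subseteq> D" by (auto simp: L_def)
  have "interior L \<subseteq> {z \<in> D. dbar D F z = 0}"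
  proof
    fix z assume z: "z \<in> interior L"
    have "dbar D F z = 0"
      using z interior_subset[of L]
      by (intro dbar_eq_0_of_locally_constant[of "interior L" _ _ _ c]) (auto simp: L_def)
    then show "z \<in> {z \<in> D. dbar D F z = 0}"
      using z interior_subset[of L] \<open>L \<subseteq> D\<close> by auto
  qed
  also have "\<dots> \<subseteq> top_of_set D closure_of {z \<in> D. dbar D F z = 0}"
    by (rule closure_of_subset) auto
  finally have "interior L \<subseteq> top_of_set D interior_of (top_of_set D closure_of {z \<in> D. dbar D F z = 0})"
    using interior_subset[of L] \<open>L \<subseteq> D\<close>
    by (intro interior_of_maximal open_subset) auto
  then have "interior L = {}"
    using nd by (simp add: nowhere_dense_in_def)
  then have "L \<in> null_sets lebesgue"
    using negligible_convex_interior[OF convex] by (simp add: L_def negligible_iff_null_sets)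
  \<comment> \<open>Closedness makes the set Borel, so that being null for the completed measure
    yields being null for \<open>lborel\<close>.\<close>
  moreover have "closed L"
    unfolding L_def using assms(1,2) by (rule continuous_closed_preimage_constant[rotated])
  ultimately show ?thesis
    by (simp add: null_sets_completion_iff L_def)
qed

lemma holder_on_imp_continuous_on:
  assumes "holder_on \<alpha> S F" "\<alpha> > 0"
  shows "continuous_on S F"
proof -
  obtain M where M: "\<And>z w. z \<in> S \<Longrightarrow> w \<in> S \<Longrightarrow> dist (F z) (F w) \<le> M * dist z w powr \<alpha>"
    using assms(1) unfolding holder_on_def by blast
  show ?thesis
    unfolding continuous_on_def
  proof
    fix z assume "z \<in> S"
    have "((\<lambda>w. M * dist w z powr \<alpha>) \<longlongrightarrow> M * dist z z powr \<alpha>) (at z within S)"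
      using \<open>\<alpha> > 0\<close> by (intro tendsto_mult tendsto_const tendsto_powr' tendsto_dist) auto
    then have lim: "((\<lambda>w. M * dist w z powr \<alpha>) \<longlongrightarrow> 0) (at z within S)"
      by simp
    have ev: "\<forall>\<^sub>F w in at z within S. dist (F w) (F z) \<le> M * dist w z powr \<alpha>"
      using M \<open>z \<in> S\<close> by (auto simp: eventually_at_filter)
    show "(F \<longlongrightarrow> F z) (at z within S)"
      by (subst tendsto_dist_iff) (rule tendsto_sandwich[OF _ ev tendsto_const lim], simp)
  qed
qed

lemma nowhere_dense_in_complement_dense:
  assumes "nowhere_dense_in (top_of_set D) E"
  shows "D \<subseteq> closure (D - E)"
proof -
  have "E \<subseteq> top_of_set D closure_of E"
    using assms by (intro closure_of_subset) (simp add: nowhere_dense_in_def)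
  then have "top_of_set D interior_of E = {}"
    using assms interior_of_mono unfolding nowhere_dense_in_def by fastforce
  then have "top_of_set D closure_of (D - E) = D"
    using closure_of_complement[of "top_of_set D" E] by simp
  moreover have "D \<inter> (D - E) = D - E" by blast
  ultimately show ?thesis
    by (simp add: closure_of_subtopology) blast
qed

theorem proposition1p4:
  fixes r \<alpha> K \<nu> :: real
    and F :: "complex \<Rightarrow> complex"
    and E :: "complex set"
  assumes "0 < r"
    and "0 < \<alpha>" and "\<alpha> < 1"
    and "holder_on \<alpha> (cball 0 r) F"
    and "nowhere_dense_in (top_of_set (cball 0 r)) E"
    and "0 < K" and "1 \<le> \<nu>"
    and "\<forall>\<zeta>\<in>cball 0 r - E. \<exists>C::complex. cmod C = 1 \<and>
           (\<forall>z\<in>cball 0 r. C * ((z - \<zeta>) * (F z - F \<zeta>)) \<in>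
              {Complex u v | u v. 0 \<le> u \<and> \<bar>v\<bar> \<le> K * u powr (1 / \<nu>)})"
  shows "polynomially_convex (graph_over (cball 0 r) F) \<and>
    (C1_on (cball 0 r) F \<and>
     nowhere_dense_in (top_of_set (cball 0 r)) {z \<in> cball 0 r. dbar (cball 0 r) F z = 0} \<and>
     finitely_connected {z \<in> cball 0 r. dbar (cball 0 r) F z = 0}
     \<longrightarrow> uniform_algebra_z (cball 0 r) F = mspace (C_space (cball 0 r)))"
proof -
  let ?D = "cball (0::complex) r"
  have F: "continuous_on ?D F"
    using assms(2,4) by (intro holder_on_imp_continuous_on)
  have mem: "w \<in> {Complex u v | u v. 0 \<le> u \<and> \<bar>v\<bar> \<le> K * u powr (1 / \<nu>)} \<longleftrightarrow>
      0 \<le> Re w \<and> \<bar>Im w\<bar> \<le> K * Re w powr (1 / \<nu>)" for w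
    by (cases w) auto
  have cusp: "\<exists>C. cmod C = 1 \<and> (\<forall>z\<in>?D.
      0 \<le> Re (C * ((z - \<zeta>) * (F z - F \<zeta>))) \<and>
      \<bar>Im (C * ((z - \<zeta>) * (F z - F \<zeta>)))\<bar> \<le> K * Re (C * ((z - \<zeta>) * (F z - F \<zeta>))) powr (1 / \<nu>))"
    if "\<zeta> \<in> ?D" for \<zeta>
    by (rule cusp_condition_dense[OF F _ nowhere_dense_in_complement_dense[OF assms(5)] Diff_subset
          bspec[OF assms(8)[unfolded mem]] that]) (use assms(7) in auto)
  then have half_plane: "\<exists>C. cmod C = 1 \<and> (\<forall>z\<in>?D. 0 \<le> Re (C * ((z - \<zeta>) * (F z - F \<zeta>))))"
    if "\<zeta> \<in> ?D" for \<zeta>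
    using that by blast
  have "convex {\<zeta> \<in> ?D. F \<zeta> = c}" for c
  proof (rule convex_level_set)
    fix \<zeta> assume "\<zeta> \<in> ?D"
    from cusp[OF this] obtain C where C: "cmod C = 1"
      "\<forall>z\<in>?D. 0 \<le> Re (C * ((z - \<zeta>) * (F z - F \<zeta>))) \<and>
        \<bar>Im (C * ((z - \<zeta>) * (F z - F \<zeta>)))\<bar> \<le> K * Re (C * ((z - \<zeta>) * (F z - F \<zeta>))) powr (1 / \<nu>)"
      by blast
    \<comment> \<open>The convention that 0 \<open>powr\<close> anything is 0 enters here: on the
      imaginary axis the bound forces the imaginary part to vanish.\<close>
    have "w = 0" if "\<bar>Im w\<bar> \<le> K * Re w powr (1 / \<nu>)" "Re w = 0" for w
      using that by (simp add: complex_eq_iff)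
    then have "\<forall>z\<in>?D. 0 \<le> Re (C * ((z - \<zeta>) * (F z - F \<zeta>))) \<and>
        (Re (C * ((z - \<zeta>) * (F z - F \<zeta>))) = 0 \<longrightarrow> C * ((z - \<zeta>) * (F z - F \<zeta>)) = 0)"
      using C(2) by blast
    moreover have "C \<noteq> 0" using C(1) by auto
    ultimately show "\<exists>C. C \<noteq> 0 \<and> (\<forall>z\<in>?D. 0 \<le> Re (C * ((z - \<zeta>) * (F z - F \<zeta>))) \<and>
        (Re (C * ((z - \<zeta>) * (F z - F \<zeta>))) = 0 \<longrightarrow> C * ((z - \<zeta>) * (F z - F \<zeta>)) = 0))"
      by blast
  qed simp
  then have cnj: "polynomially_approximable (graph_over ?D F) (\<lambda>x. cnj (x $ 1))"
    if "nowhere_dense_in (top_of_set ?D) {z \<in> ?D. dbar ?D F z = 0}"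
    using assms(1) F half_plane that
    by (intro polynomially_approximable_cnj null_sets_level_set) auto
  have "uniform_algebra_z ?D F = mspace (C_space ?D)"
    if "nowhere_dense_in (top_of_set ?D) {z \<in> ?D. dbar ?D F z = 0}"
    by (rule uniform_algebra_z_eqI[OF compact_cball F
          polynomially_approximable_continuous[OF compact_cball F cnj[OF that]]])
  moreover have "polynomially_convex (graph_over ?D F)"
    using less_imp_le[OF assms(1)] F half_plane by (rule polynomially_convex_graph_over_cball)
  ultimately show ?thesis by blast
qed

end
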